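(* Let $p\in(d,\infty)$. There exists a constant $S_\infty(\Omega,\eta)>0$, depending only on $\Omega$ and $\eta$, such that the following holds. Assume: (i) for some $K\le S_\infty(\Omega,\eta)$ (with $K>0$) there is a sequence of Borel maps $T_n:\Omega\to V_n$ with $T_n\#\mu=\mu_n$ and $\sup_{x\in\Omega}|T_n(x)-x|\le K\varepsilon_n$ for every $n\in\mathbb N$; (ii) $\eta$ is continuous at $0$, non-increasing, and $\eta(0)>0$; (iii) there is $D>0$ with $\frac1D\le\rho(x)\le D$ for all $x\in\Omega$. Additionally assume there exists $t>p$ such that $\aleph_\eta^t<+\infty$, and that the sequence $\left(\frac{\varepsilon_n^p\Lambda_n^+}{(\Lambda_n^-)^2}\right)_{n\in\mathbb N}$ is bounded. Let $(u_n)_{n\in\mathbb N}$ be a sequence of functions $u_n:V_n\to\mathbb R$ such that $(\|u_n\|_{L^p(V_n;\mu_n)})_{n\in\mathbb N}$ and $(\mathcal{GE}_n^p(u_n))_{n\in\mathbb N}$ are bounded. Then, for any $r\in[1,+\infty)$, the sequence $\big((u_n,\mu_n)\big)_{n\in\mathbb N}$ is relatively compact in $TL^r(\Omega)$.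
   Context: $\mathbb N=\{1,2,\dots\}$; $d\in\mathbb N$; $\Omega\subset\mathbb R^d$ is open and bounded with Lipschitz boundary (near each boundary point, in suitable orthonormal coordinates, $\Omega$ is the region on one side of the graph of a Lipschitz function). $\mu$ is a probability measure on $\Omega$ with continuous density $\rho:\Omega\to\mathbb R$ with respect to Lebesgue measure. For $n\in\mathbb N$, $V_n\subset\Omega$ is a finite set, $\mu_n$ is a probability measure on $V_n$ (also regarded as a measure on $\Omega$, so that functions on $V_n$ are elements of $L^r(\Omega;\mu_n)$), $\mu_n(x):=\mu_n(\{x\})$, $\Lambda_n^-:=\min_{x\in V_n}\mu_n(x)$, $\Lambda_n^+:=\max_{x\in V_n}\mu_n(x)$. $(\varepsilon_n)_{n\in\mathbb N}$ is a sequence of positive reals with $\varepsilon_n\to0$. The kernel is a function $\eta:[0,\infty)\to[0,\infty)$, and $\eta_\varepsilon(r):=\varepsilon^{-d}\eta(r/\varepsilon)$ for $\varepsilon>0$. For $t\ge0$, $\aleph_\eta^t:=\int_0^\infty\eta(r)r^{d+t-1}\,dr$. The push-forward is $T\#\mu(A):=\mu(T^{-1}(A))$. For $u:V_n\to\mathbb R$ and $p\ge1$, $$\|u\|_{L^p(V_n;\mu_n)}:=\Big(\sum_{x\in V_n}|u(x)|^p\mu_n(x)\Big)^{1/p},\qquad \mathcal{GE}_n^p(u):=\frac1{\varepsilon_n^p}\sum_{x\in V_n}\sum_{y\in V_n}\eta_{\varepsilon_n}(|x-y|)|u(x)-u(y)|^p\mu_n(x)\mu_n(y).$$ For $r\ge1$,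 $TL^r(\Omega)$ is the set of pairs $(f,\nu)$ with $\nu$ a Borel probability measure on $\Omega$ with finite $r$-th moment and $f\in L^r(\Omega;\nu)$, with the metric $$d_{TL^r(\Omega)}\big((f,\nu),(g,\lambda)\big):=\inf_{\gamma\in\Gamma(\nu,\lambda)}\Big(\int_{\Omega\times\Omega}|x-y|^r+|f(x)-g(y)|^r\,d\gamma(x,y)\Big)^{1/r},$$ where $\Gamma(\nu,\lambda)$ is the set of couplings of $\nu$ and $\lambda$. A sequence is relatively compact if every subsequence has a further subsequence converging in $TL^r(\Omega)$. *)

theory Defs
  imports "HOL-Probability.Probability"
begin

text \<open>
  Measures on a domain \<open>\<Omega>\<close> are measures with underlying sigma-algebra
  \<open>restrict_space borel \<Omega>\<close>, so that their space is \<open>\<Omega>\<close> itself.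
  A function on \<open>\<Omega>\<close> or on \<open>[0,\<infinity>)\<close> is given by a total function whose values elsewhere
  are never used. Sequences are indexed by \<^typ>\<open>nat\<close>, the index having no other role.
\<close>

text \<open>
  In orthonormal coordinates whose last axis is the unit vector \<open>v\<close>, a point \<open>y\<close> has last
  coordinate \<open>y \<bullet> v\<close> and its remaining coordinates are those of the projection
  \<open>y - (y \<bullet> v) v\<close> onto the hyperplane orthogonal to \<open>v\<close>.
\<close>

definition lipschitz_boundary :: "'a::euclidean_space set \<Rightarrow> bool" where
  "lipschitz_boundary \<Omega> \<longleftrightarrow>
     (\<forall>x\<in>frontier \<Omega>. \<exists>v s g L. norm v = 1 \<and> s > 0 \<and> L-lipschitz_on {z. z \<bullet> v = 0} (g :: 'a \<Rightarrow> real) \<and>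
        \<Omega> \<inter> ball x s = {y \<in> ball x s. y \<bullet> v < g (y - (y \<bullet> v) *\<^sub>R v)})"

definition prob_on :: "'a::euclidean_space set \<Rightarrow> 'a measure \<Rightarrow> bool" where
  "prob_on \<Omega> \<nu> \<longleftrightarrow> prob_space \<nu> \<and> sets \<nu> = sets (restrict_space borel \<Omega>)"

definition has_continuous_density ::
    "'a::euclidean_space set \<Rightarrow> 'a measure \<Rightarrow> ('a \<Rightarrow> real) \<Rightarrow> bool" where
  "has_continuous_density \<Omega> \<mu> \<rho> \<longleftrightarrow>
     continuous_on \<Omega> \<rho> \<and> (\<forall>x\<in>\<Omega>. 0 \<le> \<rho> x) \<and>
     \<mu> = density (restrict_space lborel \<Omega>) (\<lambda>x. ennreal (\<rho> x))"

text \<open>A probability measure on the finite set \<open>V\<close>, regarded as a measure on \<open>\<Omega>\<close>.\<close>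

definition prob_on_finite :: "'a::euclidean_space set \<Rightarrow> 'a set \<Rightarrow> 'a measure \<Rightarrow> bool" where
  "prob_on_finite \<Omega> V \<nu> \<longleftrightarrow> finite V \<and> V \<subseteq> \<Omega> \<and> prob_on \<Omega> \<nu> \<and> emeasure \<nu> V = 1"

definition Lambda_minus :: "'a set \<Rightarrow> 'a measure \<Rightarrow> real" where
  "Lambda_minus V \<nu> = Min ((\<lambda>x. measure \<nu> {x}) ` V)"

definition Lambda_plus :: "'a set \<Rightarrow> 'a measure \<Rightarrow> real" where
  "Lambda_plus V \<nu> = Max ((\<lambda>x. measure \<nu> {x}) ` V)"

definition rescaled_kernel :: "nat \<Rightarrow> (real \<Rightarrow> real) \<Rightarrow> real \<Rightarrow> real \<Rightarrow> real" where
  "rescaled_kernel d \<eta> \<epsilon> s = \<eta> (s / \<epsilon>) / \<epsilon> ^ d"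

definition kernel_moment :: "nat \<Rightarrow> (real \<Rightarrow> real) \<Rightarrow> real \<Rightarrow> ennreal" where
  "kernel_moment d \<eta> t = (\<integral>\<^sup>+ s\<in>{0..}. ennreal (\<eta> s * s powr (real d + t - 1)) \<partial>lborel)"

definition discrete_Lp_norm :: "'a set \<Rightarrow> 'a measure \<Rightarrow> real \<Rightarrow> ('a \<Rightarrow> real) \<Rightarrow> real" where
  "discrete_Lp_norm V \<nu> p u = (\<Sum>x\<in>V. \<bar>u x\<bar> powr p * measure \<nu> {x}) powr (1 / p)"

definition graph_energy ::
    "(real \<Rightarrow> real) \<Rightarrow> real \<Rightarrow> real \<Rightarrow> 'a::euclidean_space set \<Rightarrow> 'a measure \<Rightarrow> ('a \<Rightarrow> real) \<Rightarrow> real" where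
  "graph_energy \<eta> p \<epsilon> V \<nu> u =
     1 / \<epsilon> powr p *
       (\<Sum>x\<in>V. \<Sum>y\<in>V. rescaled_kernel DIM('a) \<eta> \<epsilon> (norm (x - y)) * \<bar>u x - u y\<bar> powr p
                          * measure \<nu> {x} * measure \<nu> {y})"

text \<open>
  A function on \<open>V\<close> determines an element of \<open>L\<^sup>r(\<Omega>; \<nu>)\<close> when \<open>\<nu>\<close> is concentrated on \<open>V\<close>;
  the extension by zero is a measurable representative.
\<close>

definition zero_extension :: "'a set \<Rightarrow> ('a \<Rightarrow> real) \<Rightarrow> 'a \<Rightarrow> real" where
  "zero_extension V u = (\<lambda>x. if x \<in> V then u x else 0)"

definition couplings :: "'a measure \<Rightarrow> 'b measure \<Rightarrow> ('a \<times> 'b) measure set" where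
  "couplings \<nu> \<kappa> = {\<gamma>. sets \<gamma> = sets (\<nu> \<Otimes>\<^sub>M \<kappa>) \<and> distr \<gamma> \<nu> fst = \<nu> \<and> distr \<gamma> \<kappa> snd = \<kappa>}"

definition TL_space :: "real \<Rightarrow> 'a::euclidean_space set \<Rightarrow> (('a \<Rightarrow> real) \<times> 'a measure) set" where
  "TL_space r \<Omega> = {(f, \<nu>). prob_on \<Omega> \<nu> \<and> integrable \<nu> (\<lambda>x. norm x powr r) \<and>
                           f \<in> borel_measurable \<nu> \<and> integrable \<nu> (\<lambda>x. \<bar>f x\<bar> powr r)}"

text \<open>
  On \<^const>\<open>TL_space\<close> the integrand below is integrable for every coupling, and the set of
  couplings contains the product measure, so the Bochner integral and the real-valued infimum
  have no degenerate cases. Members of \<^const>\<open>TL_space\<close> are functions, not classes of almost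
  everywhere equal ones, so \<open>TL_dist\<close> is a pseudometric there.
\<close>

definition TL_dist ::
    "real \<Rightarrow> ('a::euclidean_space \<Rightarrow> real) \<times> 'a measure \<Rightarrow> ('a \<Rightarrow> real) \<times> 'a measure \<Rightarrow> real" where
  "TL_dist r = (\<lambda>(f, \<nu>) (g, \<kappa>).
     INF \<gamma>\<in>couplings \<nu> \<kappa>. (\<integral>(x, y). norm (x - y) powr r + \<bar>f x - g y\<bar> powr r \<partial>\<gamma>) powr (1 / r))"

definition TL_relatively_compact ::
    "real \<Rightarrow> 'a::euclidean_space set \<Rightarrow> (nat \<Rightarrow> ('a \<Rightarrow> real) \<times> 'a measure) \<Rightarrow> bool" where
  "TL_relatively_compact r \<Omega> a \<longleftrightarrow>
     (\<forall>n. a n \<in> TL_space r \<Omega>) \<and>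
     (\<forall>k :: nat \<Rightarrow> nat. strict_mono k \<longrightarrow>
        (\<exists>l :: nat \<Rightarrow> nat. strict_mono l \<and>
           (\<exists>b\<in>TL_space r \<Omega>. (\<lambda>n. TL_dist r (a (k (l n))) b) \<longlonglongrightarrow> 0)))"

end

theory Submission
  imports Defs "HOL-Complex_Analysis.Great_Picard"
begin

text \<open>
  The map \<open>T n\<close> couples \<open>\<mu>\<close> with \<open>\<mu>\<^sub>n n\<close> by the plan \<open>(T n, id)\<close> and moves points by at most
  \<open>K * \<epsilon> n\<close>, which tends to 0. The graph functions therefore converge in \<open>TL\<^sup>r\<close> as soon as the pulled
  back functions \<open>f n = u n \<circ> T n\<close> converge in \<open>L\<^sup>r(\<mu>)\<close>, and if these are uniformly bounded,
  convergence almost everywhere is enough for all \<open>r\<close> at once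
  (\<open>TL_limit_of_bounded_AE_convergent\<close>). It remains to find a uniform bound and an almost everywhere
  convergent subsequence.

  Both come from Morrey's argument for \<open>p > d\<close>, carried out above the resolution of the graph. The kernel is
  at least \<open>\<eta> 0 / 2\<close> on some interval \<open>{0..s0}\<close>. If \<open>K \<le> s0 / 4\<close>, then points at distance at most
  \<open>\<tau> = s0 * \<epsilon> n / 2\<close> have images at distance at most \<open>s0 * \<epsilon> n\<close>, so the graph energy bounds the integral of
  \<open>\<bar>f n x - f n y\<bar> powr p\<close> over all pairs at distance at most \<open>\<tau>\<close> by \<open>B * \<tau> powr (p + d)\<close>.
  Inserting midpoints on a convex set multiplies this energy by at most \<open>2 powr (p + d)\<close> when the
  scale is doubled (\<open>jump_energy_double\<close>), so the same bound holds at every dyadic multiple of \<open>\<tau>\<close>.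
  Hence the means of \<open>f n\<close> over nested convex sets of sizes \<open>\<rho>\<close> and \<open>2 * \<rho>\<close> differ by at most a constant times
  \<open>\<rho> powr (1 - d / p)\<close>, and the sum over all dyadic \<open>\<rho>\<close> from \<open>\<tau>\<close> up to a fixed size is bounded, being
  a geometric series (\<open>mean_deviation_chain\<close>).

  For the uniform bound (\<open>sup_bound\<close>), the convex sets are scaled copies of an interior cone with vertex at the
  given point; a Lipschitz boundary provides cones of uniform size
  (\<open>lipschitz_boundary_uniform_cone\<close>). The mean at the fixed size is controlled by the \<open>L\<^sup>p\<close> norm, and the
  value at the vertex differs from the mean at scale \<open>\<tau>\<close> by a quantity controlled by
  \<open>\<epsilon> n powr p / Lambda_minus\<close>, which the hypothesis on the masses bounds.

  For convergence (\<open>subsequence_converges_AE\<close>), the difference between a value and its mean at scale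
  \<open>\<tau>\<close> tends to 0 almost everywhere along a subsequence, since its \<open>p\<close>-th power is dominated by a local energy
  that tends to 0 in \<open>L\<^sup>1\<close>. So the functions are Hoelder continuous with exponent \<open>1 - d / p\<close> up to a vanishing
  error (\<open>holder_interior\<close>), and an Arzela--Ascoli argument applies.
\<close>


section \<open>Nonlocal energies and the doubling of scales\<close>

text \<open>
  The integrand of a nonlocal \<open>p\<close>-energy at scale \<open>\<delta>\<close> on \<open>A\<close>. Cutting off inside the integrand, with
  values in \<^typ>\<open>ennreal\<close>, lets every integral below range over the whole space.
\<close>
definition jump :: "'a::euclidean_space set \<Rightarrow> real \<Rightarrow> real \<Rightarrow> ('a \<Rightarrow> real) \<Rightarrow> 'a \<Rightarrow> 'a \<Rightarrow> ennreal" where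
  "jump A \<delta> p f x y =
     (if x \<in> A \<and> y \<in> A \<and> dist x y \<le> \<delta> then ennreal (\<bar>f x - f y\<bar> powr p) else 0)"

definition jump_energy :: "'a::euclidean_space set \<Rightarrow> real \<Rightarrow> real \<Rightarrow> ('a \<Rightarrow> real) \<Rightarrow> ennreal" where
  "jump_energy A \<delta> p f = (\<integral>\<^sup>+x. \<integral>\<^sup>+y. jump A \<delta> p f x y \<partial>lborel \<partial>lborel)"

lemma measurable_jump [measurable (raw)]:
  assumes [measurable]: "A \<in> sets borel" "f \<in> borel_measurable borel"
    "g \<in> M \<rightarrow>\<^sub>M borel" "h \<in> M \<rightarrow>\<^sub>M borel"
  shows "(\<lambda>w. jump A \<delta> p f (g w) (h w)) \<in> borel_measurable M"
  unfolding jump_def by measurable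

lemma jump_mono: "A \<subseteq> B \<Longrightarrow> \<delta> \<le> \<delta>' \<Longrightarrow> jump A \<delta> p f x y \<le> jump B \<delta>' p f x y"
  by (auto simp: jump_def)

lemma jump_energy_mono: "A \<subseteq> B \<Longrightarrow> \<delta> \<le> \<delta>' \<Longrightarrow> jump_energy A \<delta> p f \<le> jump_energy B \<delta>' p f"
  unfolding jump_energy_def by (intro nn_integral_mono jump_mono)

lemma nn_integral_lborel_affine:
  fixes t :: "'a::euclidean_space"
  assumes [measurable]: "f \<in> borel_measurable borel" and c: "c \<noteq> 0"
  shows "(\<integral>\<^sup>+x. f x \<partial>lborel) = ennreal (\<bar>c\<bar> ^ DIM('a)) * (\<integral>\<^sup>+x. f (t + c *\<^sub>R x) \<partial>lborel)"
  by (subst lborel_affine[OF c, of t])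
     (simp add: nn_integral_density nn_integral_distr nn_integral_cmult)

text \<open>
  The factor \<open>2 powr (p - 1)\<close> from convexity is what makes the energy scale with the exact exponent
  \<open>p + d\<close>; the cruder factor \<open>2 powr p\<close> would lose a power of the scale at each doubling.
\<close>
lemma abs_add_powr_le:
  fixes a b p :: real
  assumes p: "1 \<le> p"
  shows "\<bar>a + b\<bar> powr p \<le> 2 powr (p - 1) * (\<bar>a\<bar> powr p + \<bar>b\<bar> powr p)"
proof -
  have 2: "1 \<le> 2 powr (p - 1)"
    using p by (simp add: ge_one_powr_ge_zero)
  consider "a = 0" | "b = 0" | "a \<noteq> 0" "b \<noteq> 0" by blast
  then show ?thesis
  proof cases
    case 1
    then show ?thesis using mult_right_mono[OF 2, of "\<bar>b\<bar> powr p"] by simp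
  next
    case 2
    then show ?thesis using mult_right_mono[OF \<open>1 \<le> 2 powr (p - 1)\<close>, of "\<bar>a\<bar> powr p"] by simp
  next
    case 3
    have "((1 - 1/2) *\<^sub>R \<bar>a\<bar> + (1/2) *\<^sub>R \<bar>b\<bar>) powr p \<le> (1 - 1/2) * \<bar>a\<bar> powr p + (1/2) * \<bar>b\<bar> powr p"
      using 3 by (intro convex_onD[OF powr_convex[OF p]]) auto
    hence 1: "((\<bar>a\<bar> + \<bar>b\<bar>) / 2) powr p \<le> (\<bar>a\<bar> powr p + \<bar>b\<bar> powr p) / 2"
      by (simp add: field_simps)
    have "\<bar>a + b\<bar> powr p \<le> (\<bar>a\<bar> + \<bar>b\<bar>) powr p"
      using p by (intro powr_mono2) auto
    also have "\<dots> = 2 powr p * ((\<bar>a\<bar> + \<bar>b\<bar>) / 2) powr p"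
      by (simp add: powr_divide)
    also have "\<dots> \<le> 2 powr p * ((\<bar>a\<bar> powr p + \<bar>b\<bar> powr p) / 2)"
      using 1 by (intro mult_left_mono) auto
    also have "\<dots> = 2 powr (p - 1) * (\<bar>a\<bar> powr p + \<bar>b\<bar> powr p)"
      by (simp add: powr_diff)
    finally show ?thesis .
  qed
qed

text \<open>
  A jump from \<open>x\<close> to \<open>y\<close> is split at the midpoint, which stays in \<open>C\<close> by convexity, into two jumps
  of half the length. Each half contributes \<open>2 powr (p - 1)\<close> times \<open>2 ^ d\<close> times the energy at
  scale \<open>\<delta>\<close>, the second factor being the Jacobian of \<open>y \<mapsto> (x + y) / 2\<close>.
\<close>
lemma jump_energy_double:
  fixes C :: "'a::euclidean_space set"
  assumes "convex C" and [measurable]: "C \<in> sets borel" "f \<in> borel_measurable borel" and p: "1 \<le> p"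
  shows "jump_energy C (2 * \<delta>) p f \<le> ennreal (2 powr (p + real DIM('a))) * jump_energy C \<delta> p f"
proof -
  define m where "m x y = (1/2) *\<^sub>R x + (1/2) *\<^sub>R y" for x y :: 'a
  have m_measurable [measurable (raw)]: "(\<lambda>w. m (g w) (h w)) \<in> borel_measurable M"
    if [measurable]: "g \<in> borel_measurable M" "h \<in> borel_measurable M" for g h and M :: "'b measure"
    unfolding m_def by measurable
  have pw: "jump C (2 * \<delta>) p f x y
      \<le> ennreal (2 powr (p - 1)) * (jump C \<delta> p f x (m x y) + jump C \<delta> p f y (m x y))" for x y
  proof (cases "x \<in> C \<and> y \<in> C \<and> dist x y \<le> 2 * \<delta>")
    case True
    have mC: "m x y \<in> C"
      using True \<open>convex C\<close> unfolding m_def convex_def by auto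
    have "x - m x y = (1/2) *\<^sub>R (x - y)" "y - m x y = (1/2) *\<^sub>R (y - x)"
      by (simp_all add: m_def algebra_simps flip: scaleR_add_left)
    hence d: "dist x (m x y) \<le> \<delta>" "dist y (m x y) \<le> \<delta>"
      using True by (auto simp: dist_norm norm_minus_commute)
    have "\<bar>f x - f y\<bar> powr p = \<bar>(f x - f (m x y)) + (f (m x y) - f y)\<bar> powr p" by simp
    also have "\<dots> \<le> 2 powr (p - 1) * (\<bar>f x - f (m x y)\<bar> powr p + \<bar>f y - f (m x y)\<bar> powr p)"
      using abs_add_powr_le[OF p, of "f x - f (m x y)" "f (m x y) - f y"]
      by (simp add: abs_minus_commute)
    finally show ?thesis
      using True mC d by (simp add: jump_def ennreal_leI flip: ennreal_mult ennreal_plus)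
  next
    case False
    then have "jump C (2 * \<delta>) p f x y = 0" by (auto simp: jump_def)
    then show ?thesis by simp
  qed
  \<comment> \<open>For fixed \<open>x\<close> the midpoint runs over the space at half the speed of \<open>y\<close>.\<close>
  have half: "(\<integral>\<^sup>+y. jump C \<delta> p f x (m x y) \<partial>lborel)
      = ennreal (2 ^ DIM('a)) * (\<integral>\<^sup>+z. jump C \<delta> p f x z \<partial>lborel)" for x
  proof -
    have "(\<integral>\<^sup>+y. jump C \<delta> p f x (m x y) \<partial>lborel)
        = ennreal (\<bar>2\<bar> ^ DIM('a)) * (\<integral>\<^sup>+z. jump C \<delta> p f x (m x (- x + 2 *\<^sub>R z)) \<partial>lborel)"
      by (rule nn_integral_lborel_affine) auto
    also have "(\<lambda>z. m x (- x + 2 *\<^sub>R z)) = (\<lambda>z. z)"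
      by (auto simp: m_def algebra_simps)
    finally show ?thesis by (metis (no_types, lifting) abs_numeral)
  qed
  have I1: "(\<integral>\<^sup>+x. \<integral>\<^sup>+y. jump C \<delta> p f x (m x y) \<partial>lborel \<partial>lborel)
      = ennreal (2 ^ DIM('a)) * jump_energy C \<delta> p f"
    unfolding half jump_energy_def by (rule nn_integral_cmult) measurable
  have "(\<integral>\<^sup>+x. \<integral>\<^sup>+y. jump C \<delta> p f y (m x y) \<partial>lborel \<partial>lborel)
      = (\<integral>\<^sup>+y. \<integral>\<^sup>+x. jump C \<delta> p f y (m x y) \<partial>lborel \<partial>lborel)"
    by (rule lborel_pair.Fubini') measurable
  also have "\<dots> = (\<integral>\<^sup>+y. \<integral>\<^sup>+x. jump C \<delta> p f y (m y x) \<partial>lborel \<partial>lborel)"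
    by (simp add: m_def add.commute)
  finally have I2: "(\<integral>\<^sup>+x. \<integral>\<^sup>+y. jump C \<delta> p f y (m x y) \<partial>lborel \<partial>lborel)
      = ennreal (2 ^ DIM('a)) * jump_energy C \<delta> p f" using I1 by simp
  have "jump_energy C (2 * \<delta>) p f
     \<le> (\<integral>\<^sup>+x. \<integral>\<^sup>+y. ennreal (2 powr (p - 1)) * (jump C \<delta> p f x (m x y) + jump C \<delta> p f y (m x y)) \<partial>lborel \<partial>lborel)"
    unfolding jump_energy_def by (intro nn_integral_mono pw)
  also have "\<dots> = ennreal (2 powr (p - 1)) *
      ((\<integral>\<^sup>+x. \<integral>\<^sup>+y. jump C \<delta> p f x (m x y) \<partial>lborel \<partial>lborel) + (\<integral>\<^sup>+x. \<integral>\<^sup>+y. jump C \<delta> p f y (m x y) \<partial>lborel \<partial>lborel))"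
    by (simp add: nn_integral_cmult nn_integral_add)
  also have "\<dots> = (ennreal (2 powr (p - 1)) * 2 * ennreal (2 ^ DIM('a))) * jump_energy C \<delta> p f"
    unfolding I1 I2 by (simp add: mult_2 algebra_simps)
  also have "ennreal (2 powr (p - 1)) * 2 * ennreal (2 ^ DIM('a)) = ennreal (2 powr (p + real DIM('a)))"
    by (simp add: powr_diff powr_add powr_realpow flip: ennreal_mult ennreal_numeral)
  finally show ?thesis .
qed

lemma jump_energy_dyadic:
  fixes C :: "'a::euclidean_space set"
  assumes "convex C" "C \<in> sets borel" "f \<in> borel_measurable borel" "1 \<le> p"
  shows "jump_energy C (2 ^ k * \<delta>) p f
     \<le> ennreal ((2 ^ k) powr (p + real DIM('a))) * jump_energy C \<delta> p f"
proof (induction k)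
  case (Suc k)
  have "jump_energy C (2 * (2 ^ k * \<delta>)) p f
      \<le> ennreal (2 powr (p + real DIM('a))) * jump_energy C (2 ^ k * \<delta>) p f"
    by (rule jump_energy_double[OF assms])
  also have "\<dots> \<le> ennreal (2 powr (p + real DIM('a))) *
      (ennreal ((2 ^ k) powr (p + real DIM('a))) * jump_energy C \<delta> p f)"
    by (intro mult_left_mono Suc) auto
  finally show ?case
    by (simp add: powr_mult ennreal_mult ac_simps)
qed simp


section \<open>Means over convex sets at dyadic scales\<close>

text \<open>
  A first power is traded for a \<open>p\<close>-th power; optimising over \<open>h\<close> recovers Jensen's inequality up to
  a constant, without taking \<open>p\<close>-th roots of integrals.
\<close>
lemma le_add_powr:
  fixes s h p :: real
  assumes "0 \<le> s" "0 < h" "1 \<le> p"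
  shows "s \<le> h + h powr (1 - p) * s powr p"
proof (cases "s \<le> h")
  case True
  then show ?thesis by (simp add: add_increasing2)
next
  case False
  then have "s = s powr (1 - p) * s powr p"
    using assms by (simp flip: powr_add)
  also have "\<dots> \<le> h powr (1 - p) * s powr p"
    using False assms by (intro mult_right_mono powr_mono2') auto
  finally show ?thesis using assms by linarith
qed

lemma nn_integral_uniform_measure_le:
  assumes [measurable]: "P \<in> sets M" "g \<in> borel_measurable M"
    and m: "0 < m" "ennreal m \<le> emeasure M P"
  shows "(\<integral>\<^sup>+x. g x \<partial>uniform_measure M P) \<le> ennreal (1 / m) * (\<integral>\<^sup>+x. g x \<partial>M)"
proof -
  have "(\<integral>\<^sup>+x. g x \<partial>uniform_measure M P) = (\<integral>\<^sup>+x. g x * indicator P x \<partial>M) / emeasure M P"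
    by (rule nn_integral_uniform_measure) auto
  also have "\<dots> \<le> (\<integral>\<^sup>+x. g x \<partial>M) / ennreal m"
  proof -
    have "inverse (emeasure M P) \<le> inverse (ennreal m)"
    proof (cases "emeasure M P")
      case (real r)
      then have "m \<le> r" using m by simp
      then show ?thesis using real m by (simp add: inverse_ennreal)
    qed simp
    then show ?thesis
      unfolding divide_ennreal_def by (intro mult_mono nn_integral_mono) (auto simp: indicator_def)
  qed
  also have "\<dots> = ennreal (1 / m) * (\<integral>\<^sup>+x. g x \<partial>M)"
    using m by (simp add: divide_ennreal_def inverse_ennreal mult.commute inverse_eq_divide)
  finally show ?thesis .
qed

lemma mean_gap_le:
  fixes P Q C :: "'a::euclidean_space set"
  assumes [measurable]: "P \<in> sets borel" "Q \<in> sets borel" "C \<in> sets borel" "f \<in> borel_measurable borel"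
    and sub: "P \<subseteq> C" "Q \<subseteq> C" and diam: "\<And>x y. x \<in> C \<Longrightarrow> y \<in> C \<Longrightarrow> dist x y \<le> \<rho>"
    and m: "0 < m" "ennreal m \<le> emeasure lborel P" "ennreal m \<le> emeasure lborel Q"
    and fin: "emeasure lborel P < \<infinity>" "emeasure lborel Q < \<infinity>"
    and "0 < h" "1 \<le> p"
  shows "(\<integral>\<^sup>+x. \<integral>\<^sup>+y. ennreal \<bar>f x - f y\<bar> \<partial>uniform_measure lborel Q \<partial>uniform_measure lborel P)
     \<le> ennreal h + ennreal (h powr (1 - p) / m\<^sup>2) * jump_energy C \<rho> p f"
proof -
  define U where "U = uniform_measure (lborel :: 'a measure)"
  have pos: "emeasure lborel P \<noteq> 0" "emeasure lborel Q \<noteq> 0"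
    using m by (auto simp: ennreal_eq_0_iff)
  interpret P: prob_space "U P" unfolding U_def using pos fin by (intro prob_space_uniform_measure) auto
  interpret Q: prob_space "U Q" unfolding U_def using pos fin by (intro prob_space_uniform_measure) auto
  have [simp, measurable_cong]: "sets (U A) = sets borel" for A by (simp add: U_def)
  define l where "l = h powr (1 - p)"
  have l0: "0 \<le> l" by (simp add: l_def)
  have P_in: "AE x in U P. x \<in> P" and Q_in: "AE y in U Q. y \<in> Q"
    unfolding U_def by (auto intro!: AE_uniform_measureI)
  have pw: "ennreal \<bar>f x - f y\<bar> \<le> ennreal h + ennreal l * jump C \<rho> p f x y" if "x \<in> P" "y \<in> Q" for x y
  proof -
    have "x \<in> C" "y \<in> C" using that sub by auto
    then have j: "jump C \<rho> p f x y = ennreal (\<bar>f x - f y\<bar> powr p)"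
      using diam by (simp add: jump_def)
    have "ennreal \<bar>f x - f y\<bar> \<le> ennreal (h + l * \<bar>f x - f y\<bar> powr p)"
      unfolding l_def using assms by (intro ennreal_leI le_add_powr) auto
    also have "\<dots> = ennreal h + ennreal l * jump C \<rho> p f x y"
      using \<open>0 < h\<close> l0 by (simp add: j ennreal_mult)
    finally show ?thesis .
  qed
  have "(\<integral>\<^sup>+x. \<integral>\<^sup>+y. ennreal \<bar>f x - f y\<bar> \<partial>U Q \<partial>U P)
      \<le> (\<integral>\<^sup>+x. \<integral>\<^sup>+y. ennreal h + ennreal l * jump C \<rho> p f x y \<partial>U Q \<partial>U P)"
  proof (rule nn_integral_mono_AE, use P_in in eventually_elim)
    fix x assume "x \<in> P"
    show "(\<integral>\<^sup>+y. ennreal \<bar>f x - f y\<bar> \<partial>U Q) \<le> (\<integral>\<^sup>+y. ennreal h + ennreal l * jump C \<rho> p f x y \<partial>U Q)"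
      using Q_in by (intro nn_integral_mono_AE) (auto elim!: eventually_mono intro!: pw \<open>x \<in> P\<close>)
  qed
  also have "\<dots> = (\<integral>\<^sup>+x. ennreal h + ennreal l * (\<integral>\<^sup>+y. jump C \<rho> p f x y \<partial>U Q) \<partial>U P)"
    by (simp add: nn_integral_add nn_integral_cmult Q.emeasure_space_1)
  also have "\<dots> \<le> (\<integral>\<^sup>+x. ennreal h + ennreal l * (ennreal (1 / m) * (\<integral>\<^sup>+y. jump C \<rho> p f x y \<partial>lborel)) \<partial>U P)"
    unfolding U_def
    by (intro nn_integral_mono add_left_mono mult_left_mono nn_integral_uniform_measure_le) (use m in auto)
  also have "\<dots> = ennreal h + ennreal l * (ennreal (1 / m) * (\<integral>\<^sup>+x. \<integral>\<^sup>+y. jump C \<rho> p f x y \<partial>lborel \<partial>U P))"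
    by (simp add: nn_integral_add nn_integral_cmult P.emeasure_space_1)
  also have "\<dots> \<le> ennreal h + ennreal l * (ennreal (1 / m) * (ennreal (1 / m) * jump_energy C \<rho> p f))"
    unfolding jump_energy_def U_def
    by (intro nn_integral_mono add_left_mono mult_left_mono nn_integral_uniform_measure_le) (use m in auto)
  also have "ennreal l * (ennreal (1 / m) * (ennreal (1 / m) * jump_energy C \<rho> p f))
      = ennreal (l / m\<^sup>2) * jump_energy C \<rho> p f"
    using l0 m by (simp add: power2_eq_square mult.assoc[symmetric] flip: ennreal_mult)
  finally show ?thesis unfolding U_def l_def .
qed

text \<open>
  The two constants in Morrey's estimate: \<open>gap_const\<close> controls the difference of two means over sets
  that fill at least the fraction \<open>\<beta>\<close> of the volume \<open>\<rho> ^ d\<close> at one scale \<open>\<rho>\<close>. In \<open>chain_const\<close> the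
  fraction drops by \<open>2 ^ d\<close> because neighbouring scales are compared, and the denominator sums the
  geometric series with ratio \<open>2 powr - (1 - d / p)\<close> over all smaller scales.
\<close>
definition gap_const :: "real \<Rightarrow> real \<Rightarrow> real" where
  "gap_const B \<beta> = 1 + B / \<beta>\<^sup>2"

definition chain_const :: "nat \<Rightarrow> real \<Rightarrow> real \<Rightarrow> real \<Rightarrow> real" where
  "chain_const d p B \<beta> = gap_const B (\<beta> / 2 ^ d) / (1 - 2 powr (real d / p - 1))"

lemma chain_const_step:
  assumes "real d < p" "\<rho> > 0"
  shows "gap_const B (\<beta> / 2 ^ d) * (2 * \<rho>) powr (1 - real d / p) + chain_const d p B \<beta> * \<rho> powr (1 - real d / p)
    = chain_const d p B \<beta> * (2 * \<rho>) powr (1 - real d / p)"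
proof -
  define q where "q = 2 powr (real d / p - 1)"
  have "real d / p < 1" using assms by (simp add: divide_simps)
  then have q: "q < 1" unfolding q_def using powr_less_one[of 2 "real d / p - 1"] by simp
  have "\<rho> powr (1 - real d / p) = q * (2 * \<rho>) powr (1 - real d / p)"
    unfolding q_def using assms by (simp add: powr_mult mult.assoc[symmetric] flip: powr_add)
  then show ?thesis
    using q unfolding chain_const_def q_def[symmetric] by (simp add: field_simps)
qed

lemma chain_const_nonneg:
  assumes "real d < p" "0 \<le> B"
  shows "0 \<le> chain_const d p B \<beta>"
proof -
  have "real d / p < 1" using assms by (simp add: divide_simps)
  then have "2 powr (real d / p - 1) < 1" using powr_less_one[of 2 "real d / p - 1"] by simp
  then show ?thesis using assms by (auto simp: chain_const_def gap_const_def)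
qed

text \<open>
  A discrete substitute for a \<open>W\<^sup>1\<^sup>,\<^sup>p\<close> bound: a smooth \<open>f\<close> has energy of order \<open>\<tau> powr (p + d)\<close> at
  scale \<open>\<tau>\<close>, and \<open>B\<close> stands for the \<open>p\<close>-th power of the norm of the gradient. The bound carries no
  information about oscillations below the scale \<open>\<tau>\<close>.
\<close>
locale energy_at_scale =
  fixes \<Omega> :: "'a::euclidean_space set" and f :: "'a \<Rightarrow> real" and p \<tau> B :: real
  assumes domain_borel [measurable]: "\<Omega> \<in> sets borel"
    and f_borel [measurable]: "f \<in> borel_measurable borel"
    and dim_less: "real DIM('a) < p"
    and scale_pos: "0 < \<tau>"
    and B_nonneg: "0 \<le> B"
    and energy_le: "jump_energy \<Omega> \<tau> p f \<le> ennreal (B * \<tau> powr (p + real DIM('a)))"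
begin

lemma p_ge_1: "1 \<le> p"
  using dim_less DIM_positive[where 'a='a] by linarith

text \<open>Doubling preserves the bound with the same \<open>B\<close>, since \<open>\<tau> powr (p + d)\<close> doubles at the same rate.\<close>
lemma energy_coarse:
  assumes "convex C" "C \<in> sets borel" "C \<subseteq> \<Omega>"
  shows "jump_energy C (2 ^ k * \<tau>) p f \<le> ennreal (B * (2 ^ k * \<tau>) powr (p + real DIM('a)))"
proof -
  have "jump_energy C (2 ^ k * \<tau>) p f
      \<le> ennreal ((2 ^ k) powr (p + real DIM('a))) * jump_energy C \<tau> p f"
    using assms p_ge_1 by (intro jump_energy_dyadic) auto
  also have "\<dots> \<le> ennreal ((2 ^ k) powr (p + real DIM('a))) * ennreal (B * \<tau> powr (p + real DIM('a)))"
    by (intro mult_left_mono order_trans[OF jump_energy_mono energy_le] assms) auto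
  also have "\<dots> = ennreal (B * (2 ^ k * \<tau>) powr (p + real DIM('a)))"
    using B_nonneg by (simp add: powr_mult ac_simps flip: ennreal_mult)
  finally show ?thesis .
qed

text \<open>
  The choice \<open>h = \<rho> powr (1 - d / p)\<close> balances the two terms of the preceding bound on the gap.
\<close>
lemma mean_gap_at_scale:
  assumes "P \<in> sets borel" "Q \<in> sets borel" "C \<in> sets borel" "convex C" "C \<subseteq> \<Omega>"
    and "P \<subseteq> C" "Q \<subseteq> C" and "\<And>x y. x \<in> C \<Longrightarrow> y \<in> C \<Longrightarrow> dist x y \<le> 2 ^ k * \<tau>"
    and \<beta>: "0 < \<beta>" "ennreal (\<beta> * (2 ^ k * \<tau>) ^ DIM('a)) \<le> emeasure lborel P"
      "ennreal (\<beta> * (2 ^ k * \<tau>) ^ DIM('a)) \<le> emeasure lborel Q"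
    and "emeasure lborel P < \<infinity>" "emeasure lborel Q < \<infinity>"
  shows "(\<integral>\<^sup>+x. \<integral>\<^sup>+y. ennreal \<bar>f x - f y\<bar> \<partial>uniform_measure lborel Q \<partial>uniform_measure lborel P)
     \<le> ennreal (gap_const B \<beta> * (2 ^ k * \<tau>) powr (1 - real DIM('a) / p))"
proof -
  define \<rho> where "\<rho> = 2 ^ k * \<tau>"
  define d where "d = real DIM('a)"
  define h where "h = \<rho> powr (1 - d / p)"
  have \<rho>: "0 < \<rho>" using scale_pos by (simp add: \<rho>_def)
  then have h: "0 < h" by (simp add: h_def)
  have p0: "0 < p" using p_ge_1 by simp
  have rd: "\<rho> ^ DIM('a) = \<rho> powr d" using \<rho> by (simp add: d_def powr_realpow)
  have "(\<integral>\<^sup>+x. \<integral>\<^sup>+y. ennreal \<bar>f x - f y\<bar> \<partial>uniform_measure lborel Q \<partial>uniform_measure lborel P)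
     \<le> ennreal h + ennreal (h powr (1 - p) / (\<beta> * \<rho> ^ DIM('a))\<^sup>2) * jump_energy C \<rho> p f"
    using assms \<rho> h p_ge_1 unfolding \<rho>_def[symmetric] by (intro mean_gap_le) auto
  also have "\<dots> \<le> ennreal h + ennreal (h powr (1 - p) / (\<beta> * \<rho> ^ DIM('a))\<^sup>2) * ennreal (B * \<rho> powr (p + d))"
    unfolding \<rho>_def d_def using assms by (intro add_left_mono mult_left_mono energy_coarse) auto
  also have "\<dots> = ennreal (h + h powr (1 - p) / (\<beta> * \<rho> ^ DIM('a))\<^sup>2 * (B * \<rho> powr (p + d)))"
    using h B_nonneg by (subst ennreal_plus) (auto simp flip: ennreal_mult)
  also have "h powr (1 - p) / (\<beta> * \<rho> ^ DIM('a))\<^sup>2 * (B * \<rho> powr (p + d))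
      = B / \<beta>\<^sup>2 * (\<rho> powr ((1 - d / p) * (1 - p)) * \<rho> powr (p + d) / (\<rho> powr d)\<^sup>2)"
    unfolding rd h_def by (simp add: powr_powr power_mult_distrib)
  also have "\<rho> powr ((1 - d / p) * (1 - p)) * \<rho> powr (p + d) / (\<rho> powr d)\<^sup>2
      = \<rho> powr ((1 - d / p) * (1 - p) + (p + d) - 2 * d)"
  proof -
    have "\<rho> powr (2 * d) = (\<rho> powr d)\<^sup>2" by (simp add: power2_eq_square flip: powr_add)
    then show ?thesis by (simp only: powr_diff powr_add)
  qed
  also have "(1 - d / p) * (1 - p) + (p + d) - 2 * d = 1 - d / p"
    using p0 by (simp add: field_simps)
  also have "h + B / \<beta>\<^sup>2 * \<rho> powr (1 - d / p) = gap_const B \<beta> * \<rho> powr (1 - d / p)"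
    by (simp add: gap_const_def h_def algebra_simps)
  finally show ?thesis unfolding \<rho>_def d_def .
qed

text \<open>
  Passing from \<open>P k\<close> to \<open>P (k + 1)\<close> costs a multiple of \<open>(2 ^ k * \<tau>) powr (1 - d / p)\<close>. The exponent is
  positive because \<open>d < p\<close>, so the sum of the costs is dominated by the coarsest scale however many
  scales there are. Keeping the deviation from an arbitrary constant \<open>c\<close>, rather than a difference
  of means, allows all integrands to be nonnegative.
\<close>
lemma mean_deviation_chain:
  assumes P: "\<And>k. k \<le> J \<Longrightarrow> convex (P k) \<and> P k \<in> sets borel \<and> P k \<subseteq> \<Omega>"
    and nested: "\<And>k. k < J \<Longrightarrow> P k \<subseteq> P (Suc k)"
    and diam: "\<And>k x y. k \<le> J \<Longrightarrow> x \<in> P k \<Longrightarrow> y \<in> P k \<Longrightarrow> dist x y \<le> 2 ^ k * \<tau>"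
    and \<beta>: "0 < \<beta>" "\<And>k. k \<le> J \<Longrightarrow> ennreal (\<beta> * (2 ^ k * \<tau>) ^ DIM('a)) \<le> emeasure lborel (P k)"
    and fin: "\<And>k. k \<le> J \<Longrightarrow> emeasure lborel (P k) < \<infinity>"
  shows "(\<integral>\<^sup>+x. ennreal \<bar>f x - c\<bar> \<partial>uniform_measure lborel (P 0))
    \<le> (\<integral>\<^sup>+x. ennreal \<bar>f x - c\<bar> \<partial>uniform_measure lborel (P J))
       + ennreal (chain_const DIM('a) p B \<beta> * (2 ^ J * \<tau>) powr (1 - real DIM('a) / p))"
  using assms
proof (induction J)
  case (Suc J)
  define U where "U k = uniform_measure lborel (P k)" for k
  have pos: "emeasure lborel (P k) \<noteq> 0" if "k \<le> Suc J" for k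
  proof -
    have "0 < \<beta> * (2 ^ k * \<tau>) ^ DIM('a)" using \<beta>(1) scale_pos by simp
    then show ?thesis using Suc.prems(5)[OF that] by (auto simp: ennreal_eq_0_iff simp flip: not_less)
  qed
  have prob: "prob_space (U k)" if "k \<le> Suc J" for k
    unfolding U_def using pos[OF that] Suc.prems(6)[OF that] by (intro prob_space_uniform_measure) auto
  interpret A: prob_space "U J" by (rule prob) simp
  interpret B: prob_space "U (Suc J)" by (rule prob) simp
  have [simp, measurable_cong]: "sets (U k) = sets borel" for k by (simp add: U_def)
  let ?a = "1 - real DIM('a) / p" and ?K = "chain_const DIM('a) p B \<beta>" and ?G = "gap_const B (\<beta> / 2 ^ DIM('a))"
  have K0: "0 \<le> ?K" using dim_less B_nonneg by (rule chain_const_nonneg)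
  have G0: "0 \<le> ?G" using B_nonneg by (simp add: gap_const_def)
  have shrink: "\<beta> / 2 ^ DIM('a) * (2 ^ Suc J * \<tau>) ^ DIM('a) = \<beta> * (2 ^ J * \<tau>) ^ DIM('a)"
    by (simp add: power_mult_distrib)
  have "\<beta> / 2 ^ DIM('a) * (2 ^ Suc J * \<tau>) ^ DIM('a) \<le> \<beta> * (2 ^ Suc J * \<tau>) ^ DIM('a)"
    using \<beta>(1) scale_pos by (intro mult_right_mono) (auto simp: field_simps)
  then have big: "ennreal (\<beta> / 2 ^ DIM('a) * (2 ^ Suc J * \<tau>) ^ DIM('a)) \<le> emeasure lborel (P (Suc J))"
    using Suc.prems(5)[of "Suc J"] by (meson ennreal_leI order_refl order_trans)
  have gap: "(\<integral>\<^sup>+x. \<integral>\<^sup>+y. ennreal \<bar>f x - f y\<bar> \<partial>U (Suc J) \<partial>U J)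
      \<le> ennreal (?G * (2 ^ Suc J * \<tau>) powr ?a)"
    unfolding U_def
  proof (rule mean_gap_at_scale[where C = "P (Suc J)"])
    show "ennreal (\<beta> / 2 ^ DIM('a) * (2 ^ Suc J * \<tau>) ^ DIM('a)) \<le> emeasure lborel (P J)"
      unfolding shrink by (rule Suc.prems(5)) simp
    show "dist x y \<le> 2 ^ Suc J * \<tau>" if "x \<in> P (Suc J)" "y \<in> P (Suc J)" for x y
      using that by (rule Suc.prems(3)[OF order_refl])
  qed (use Suc.prems big in auto)
  have "(\<integral>\<^sup>+x. ennreal \<bar>f x - c\<bar> \<partial>U J) = (\<integral>\<^sup>+x. \<integral>\<^sup>+y. ennreal \<bar>f x - c\<bar> \<partial>U (Suc J) \<partial>U J)"
    by (simp add: B.emeasure_space_1)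
  also have "\<dots> \<le> (\<integral>\<^sup>+x. \<integral>\<^sup>+y. ennreal \<bar>f x - f y\<bar> + ennreal \<bar>f y - c\<bar> \<partial>U (Suc J) \<partial>U J)"
    by (intro nn_integral_mono) (auto simp flip: ennreal_plus intro!: ennreal_leI)
  also have "\<dots> = (\<integral>\<^sup>+x. \<integral>\<^sup>+y. ennreal \<bar>f x - f y\<bar> \<partial>U (Suc J) \<partial>U J) + (\<integral>\<^sup>+y. ennreal \<bar>f y - c\<bar> \<partial>U (Suc J))"
    by (simp add: nn_integral_add A.emeasure_space_1)
  finally have step: "(\<integral>\<^sup>+x. ennreal \<bar>f x - c\<bar> \<partial>U J)
      \<le> ennreal (?G * (2 ^ Suc J * \<tau>) powr ?a) + (\<integral>\<^sup>+y. ennreal \<bar>f y - c\<bar> \<partial>U (Suc J))"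
    using gap by (meson add_right_mono order_trans)
  have "(\<integral>\<^sup>+x. ennreal \<bar>f x - c\<bar> \<partial>U 0)
      \<le> (\<integral>\<^sup>+x. ennreal \<bar>f x - c\<bar> \<partial>U J) + ennreal (?K * (2 ^ J * \<tau>) powr ?a)"
    unfolding U_def by (rule Suc.IH) (use Suc.prems in auto)
  also have "\<dots> \<le> (ennreal (?G * (2 ^ Suc J * \<tau>) powr ?a) + (\<integral>\<^sup>+y. ennreal \<bar>f y - c\<bar> \<partial>U (Suc J)))
       + ennreal (?K * (2 ^ J * \<tau>) powr ?a)"
    by (intro add_right_mono step)
  also have "\<dots> = (\<integral>\<^sup>+y. ennreal \<bar>f y - c\<bar> \<partial>U (Suc J))
      + ennreal (?G * (2 * (2 ^ J * \<tau>)) powr ?a + ?K * (2 ^ J * \<tau>) powr ?a)"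
    using K0 G0 by (subst ennreal_plus) (auto simp: ac_simps)
  also have "?G * (2 * (2 ^ J * \<tau>)) powr ?a + ?K * (2 ^ J * \<tau>) powr ?a = ?K * (2 * (2 ^ J * \<tau>)) powr ?a"
    using dim_less scale_pos by (intro chain_const_step) auto
  finally show ?case unfolding U_def by (simp add: mult.assoc)
qed simp

end


section \<open>Uniform interior cones\<close>

text \<open>
  \<open>Q\<close> is the shape of a cone with vertex at the origin, normalised to diameter at most 1; by convexity
  \<open>z + s Q\<close> lies in \<open>\<Omega>\<close> for all \<open>s\<close> up to \<open>R\<close>. The shape may depend on \<open>z\<close>, but the size \<open>R\<close> and the
  volume bound \<open>\<beta>\<close> will not.
\<close>
definition interior_cone :: "'a::euclidean_space set \<Rightarrow> real \<Rightarrow> real \<Rightarrow> 'a \<Rightarrow> 'a set \<Rightarrow> bool" where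
  "interior_cone \<Omega> R \<beta> z Q \<longleftrightarrow>
     compact Q \<and> convex Q \<and> 0 \<in> Q \<and> Q \<subseteq> cball 0 (1/2) \<and> ennreal \<beta> \<le> emeasure lborel Q \<and>
     (\<forall>h\<in>Q. z + R *\<^sub>R h \<in> \<Omega>)"

lemma interior_cone_mono:
  assumes "interior_cone \<Omega> R \<beta> z Q" "0 \<le> R'" "R' \<le> R" "\<beta>' \<le> \<beta>"
  shows "interior_cone \<Omega> R' \<beta>' z Q"
proof -
  have Q: "convex Q" "0 \<in> Q" "\<And>h. h \<in> Q \<Longrightarrow> z + R *\<^sub>R h \<in> \<Omega>" "ennreal \<beta> \<le> emeasure lborel Q"
    using assms by (auto simp: interior_cone_def)
  have "z + R' *\<^sub>R h \<in> \<Omega>" if "h \<in> Q" for h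
  proof (cases "R = 0")
    case True
    then show ?thesis using Q(3)[OF that] assms by simp
  next
    case False
    have "(R' / R) *\<^sub>R h + (1 - R' / R) *\<^sub>R 0 \<in> Q"
      using assms False that by (intro convexD[OF Q(1)] Q(2)) (auto simp: divide_simps)
    then have "z + R *\<^sub>R ((R' / R) *\<^sub>R h) \<in> \<Omega>" by (intro Q(3)) simp
    then show ?thesis using False by simp
  qed
  moreover have "ennreal \<beta>' \<le> emeasure lborel Q"
    using Q(4) assms by (meson ennreal_leI order_trans)
  ultimately show ?thesis using assms by (simp add: interior_cone_def)
qed

lemma interior_cone_cball:
  fixes \<Omega> :: "'a::euclidean_space set"
  assumes "ball x s \<subseteq> \<Omega>" "z \<in> ball x (s / 2)"
  shows "interior_cone \<Omega> s (measure lborel (cball (0 :: 'a) (1/2))) z (cball 0 (1/2))"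
proof -
  have "z + s *\<^sub>R h \<in> \<Omega>" if "h \<in> cball 0 (1/2)" for h
  proof -
    have s: "0 < s" using assms(2) by (metis dist_not_less_zero half_gt_zero_iff linorder_neqE_linordered_idom mem_ball order_less_trans)
    have "dist x (z + s *\<^sub>R h) \<le> dist x z + norm (s *\<^sub>R h)"
      by (metis add_diff_cancel_left' dist_norm dist_triangle norm_minus_commute)
    also have "\<dots> < s / 2 + s * (1/2)"
      using assms(2) that s by (intro add_less_le_mono) auto
    finally show ?thesis using assms(1) by auto
  qed
  moreover have "emeasure lborel (cball (0::'a) (1/2)) = ennreal (measure lborel (cball (0::'a) (1/2)))"
    by (intro emeasure_eq_ennreal_measure) (simp add: emeasure_cball)
  ultimately show ?thesis unfolding interior_cone_def by auto
qed

text \<open>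
  Below the graph of an \<open>L\<close>-Lipschitz function one may descend from any point in every direction of slope
  at least \<open>L\<close>: the graph cannot fall faster than that.
\<close>
lemma interior_cone_below_graph:
  fixes g :: "'a::euclidean_space \<Rightarrow> real"
  assumes v: "norm v = 1" and g: "L-lipschitz_on {z. z \<bullet> v = 0} g"
    and graph: "\<Omega> \<inter> ball x s = {y \<in> ball x s. y \<bullet> v < g (y - (y \<bullet> v) *\<^sub>R v)}"
    and z: "z \<in> \<Omega>" "z \<in> ball x (s / 2)"
  shows "interior_cone \<Omega> s (measure lborel (ball (0::'a) (1 / (4 * (1 + 2 * L))))) z
           {h \<in> cball 0 (1/2). h \<bullet> v + L * norm (h - (h \<bullet> v) *\<^sub>R v) \<le> 0}"
    (is "interior_cone _ _ ?\<beta> _ ?Q")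
proof -
  define perp where "perp h = h - (h \<bullet> v) *\<^sub>R v" for h :: 'a
  have L: "0 \<le> L" using g by (rule lipschitz_on_nonneg)
  have vv: "v \<bullet> v = 1" using v by (simp add: dot_square_norm)
  have perp_lin: "linear perp"
    by (rule linearI) (simp_all add: perp_def inner_add_left algebra_simps)
  have perp_orth: "perp h \<bullet> v = 0" for h
    by (simp add: perp_def inner_diff_left vv)
  have Q: "?Q = {h \<in> cball 0 (1/2). h \<bullet> v + L * norm (perp h) \<le> 0}" by (simp add: perp_def)
  have "closed {h. h \<bullet> v + L * norm (perp h) \<le> 0}"
    unfolding perp_def by (intro closed_Collect_le continuous_intros)
  then have "compact (cball 0 (1/2) \<inter> {h. h \<bullet> v + L * norm (perp h) \<le> 0})"
    by (intro compact_Int_closed compact_cball)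
  then have "compact ?Q"
    unfolding Q by (simp only: Collect_conj_eq Collect_mem_eq)
  moreover have "convex ?Q"
  proof -
    have cv: "convex_on UNIV (\<lambda>h. h \<bullet> v + L * norm (perp h))"
    proof (rule convex_onI)
      fix t :: real and a b :: 'a assume t: "0 < t" "t < 1"
      have "norm (perp ((1 - t) *\<^sub>R a + t *\<^sub>R b)) \<le> (1 - t) * norm (perp a) + t * norm (perp b)"
        using t norm_triangle_ineq[of "(1 - t) *\<^sub>R perp a" "t *\<^sub>R perp b"]
        by (simp add: linear_add[OF perp_lin] linear_cmul[OF perp_lin])
      then have "L * norm (perp ((1 - t) *\<^sub>R a + t *\<^sub>R b)) \<le> L * ((1 - t) * norm (perp a) + t * norm (perp b))"
        using L by (rule mult_left_mono)
      then show "((1 - t) *\<^sub>R a + t *\<^sub>R b) \<bullet> v + L * norm (perp ((1 - t) *\<^sub>R a + t *\<^sub>R b))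
          \<le> (1 - t) * (a \<bullet> v + L * norm (perp a)) + t * (b \<bullet> v + L * norm (perp b))"
        by (simp add: inner_add_left algebra_simps)
    qed simp
    have "convex {h. h \<bullet> v + L * norm (perp h) \<le> 0}"
      unfolding convex_alt
    proof (intro ballI allI impI CollectI)
      fix a b :: 'a and t :: real
      assume ab: "a \<in> {h. h \<bullet> v + L * norm (perp h) \<le> 0}" "b \<in> {h. h \<bullet> v + L * norm (perp h) \<le> 0}"
        and t: "0 \<le> t \<and> t \<le> 1"
      have "((1 - t) *\<^sub>R a + t *\<^sub>R b) \<bullet> v + L * norm (perp ((1 - t) *\<^sub>R a + t *\<^sub>R b))
          \<le> (1 - t) * (a \<bullet> v + L * norm (perp a)) + t * (b \<bullet> v + L * norm (perp b))"
        using convex_onD[OF cv, of t a b] t by simp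
      also have "\<dots> \<le> 0"
        using ab t by (intro add_nonpos_nonpos[OF mult_nonneg_nonpos mult_nonneg_nonpos]) auto
      finally show "((1 - t) *\<^sub>R a + t *\<^sub>R b) \<bullet> v + L * norm (perp ((1 - t) *\<^sub>R a + t *\<^sub>R b)) \<le> 0" .
    qed
    then show ?thesis
      unfolding Q Collect_conj_eq Collect_mem_eq by (intro convex_Int convex_cball)
  qed
  moreover have "0 \<in> ?Q" by simp
  moreover have "ennreal ?\<beta> \<le> emeasure lborel ?Q"
  proof -
    define \<kappa> where "\<kappa> = 1 / (4 * (1 + 2 * L))"
    have \<kappa>: "0 < \<kappa>" "\<kappa> \<le> 1/4" "\<kappa> * (1 + 2 * L) = 1/4"
      using L by (auto simp: \<kappa>_def divide_simps)
    \<comment> \<open>A ball around \<open>-v/4\<close> fits into the cone.\<close>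
    have "ball (- (1/4) *\<^sub>R v) \<kappa> \<subseteq> ?Q"
    proof
      fix h assume "h \<in> ball (- (1/4) *\<^sub>R v) \<kappa>"
      define k where "k = h + (1/4) *\<^sub>R v"
      have k: "norm k < \<kappa>" and h: "h = k - (1/4) *\<^sub>R v"
        using \<open>h \<in> _\<close> by (auto simp: k_def dist_norm norm_minus_commute)
      have kv: "\<bar>k \<bullet> v\<bar> \<le> norm k" using Cauchy_Schwarz_ineq2[of k v] v by simp
      have "norm h \<le> norm k + norm ((1/4) *\<^sub>R v)" unfolding h by (rule norm_triangle_ineq4)
      then have "norm h \<le> 1/2" using k \<kappa> v by simp
      moreover have "h \<bullet> v + L * norm (perp h) \<le> 0"
      proof -
        have "perp h = k - (k \<bullet> v) *\<^sub>R v"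
          by (simp add: perp_def h inner_diff_left vv algebra_simps)
        then have "norm (perp h) \<le> norm k + \<bar>k \<bullet> v\<bar>"
          using norm_triangle_ineq4[of k "(k \<bullet> v) *\<^sub>R v"] v by simp
        then have "norm (perp h) \<le> 2 * \<kappa>" using k kv by linarith
        then have "L * norm (perp h) \<le> L * (2 * \<kappa>)" using L by (rule mult_left_mono)
        moreover have "h \<bullet> v \<le> \<kappa> - 1/4" using kv k by (simp add: h inner_diff_left vv)
        ultimately show ?thesis using \<kappa>(3) by (simp add: algebra_simps)
      qed
      ultimately show "h \<in> ?Q" by (simp add: perp_def)
    qed
    then have "emeasure lborel (ball (- (1/4) *\<^sub>R v) \<kappa>) \<le> emeasure lborel ?Q"
      using \<open>compact ?Q\<close> by (intro emeasure_mono) (auto intro: borel_closed compact_imp_closed)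
    moreover have "emeasure lborel (ball (- (1/4) *\<^sub>R v) \<kappa>) = ennreal ?\<beta>"
      unfolding \<kappa>_def[symmetric] using \<kappa> by (simp add: emeasure_ball content_ball)
    ultimately show ?thesis by simp
  qed
  moreover have "z + s *\<^sub>R h \<in> \<Omega>" if h: "h \<in> ?Q" for h
  proof -
    have s: "0 < s" using z(2) by (metis dist_not_less_zero half_gt_zero_iff linorder_neqE_linordered_idom mem_ball order_less_trans)
    have "dist x (z + s *\<^sub>R h) \<le> dist x z + norm (s *\<^sub>R h)"
      by (metis add_diff_cancel_left' dist_norm dist_triangle norm_minus_commute)
    also have "\<dots> < s / 2 + s * (1/2)"
      using z h s by (intro add_less_le_mono) auto
    finally have inb: "z + s *\<^sub>R h \<in> ball x s" by simp
    have zz: "z \<bullet> v < g (perp z)"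
    proof -
      have "z \<in> \<Omega> \<inter> ball x s" using z s by auto
      then show ?thesis unfolding graph perp_def by simp
    qed
    have "(z + s *\<^sub>R h) \<bullet> v < g (perp z) + s * (h \<bullet> v)" using zz by (simp add: inner_add_left)
    also have "\<dots> \<le> g (perp z) - s * (L * norm (perp h))"
    proof -
      have "s * (h \<bullet> v) \<le> s * - (L * norm (perp h))"
        using h s by (intro mult_left_mono) (auto simp: perp_def)
      then show ?thesis by simp
    qed
    also have "\<dots> \<le> g (perp (z + s *\<^sub>R h))"
    proof -
      have "dist (g (perp z)) (g (perp (z + s *\<^sub>R h))) \<le> L * dist (perp z) (perp (z + s *\<^sub>R h))"
        using perp_orth by (intro lipschitz_onD[OF g]) auto
      also have "dist (perp z) (perp (z + s *\<^sub>R h)) = s * norm (perp h)"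
        using s by (simp add: dist_norm linear_add[OF perp_lin] linear_cmul[OF perp_lin])
      finally show ?thesis by (simp add: dist_real_def abs_le_iff algebra_simps)
    qed
    finally have "z + s *\<^sub>R h \<in> \<Omega> \<inter> ball x s" unfolding graph using inb by (simp add: perp_def)
    then show ?thesis by simp
  qed
  ultimately show ?thesis unfolding interior_cone_def by blast
qed

text \<open>
  Each point of the closure has a neighbourhood with a common cone size, given by a ball inside \<open>\<Omega>\<close>
  or by a boundary chart; finitely many neighbourhoods suffice by compactness.
\<close>
lemma lipschitz_boundary_uniform_cone:
  fixes \<Omega> :: "'a::euclidean_space set"
  assumes "open \<Omega>" "bounded \<Omega>" "lipschitz_boundary \<Omega>"
  obtains R \<beta> where "0 < R" "0 < \<beta>" "\<And>z. z \<in> \<Omega> \<Longrightarrow> \<exists>Q. interior_cone \<Omega> R \<beta> z Q"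
proof -
  have "\<exists>s \<beta>. 0 < s \<and> 0 < \<beta> \<and> (\<forall>z\<in>\<Omega> \<inter> ball x (s / 2). \<exists>Q. interior_cone \<Omega> s \<beta> z Q)"
    if "x \<in> closure \<Omega>" for x
  proof (cases "x \<in> \<Omega>")
    case True
    then obtain s where "0 < s" "ball x s \<subseteq> \<Omega>"
      using \<open>open \<Omega>\<close> by (auto simp: open_contains_ball)
    then have "\<forall>z\<in>\<Omega> \<inter> ball x (s / 2). interior_cone \<Omega> s (measure lborel (cball (0 :: 'a) (1/2))) z (cball 0 (1/2))"
      using interior_cone_cball by blast
    moreover have "0 < measure lborel (cball (0 :: 'a) (1/2))"
      by (simp add: content_cball)
    ultimately show ?thesis using \<open>0 < s\<close> by blast
  next
    case False
    then have "x \<in> frontier \<Omega>" using that \<open>open \<Omega>\<close> by (simp add: frontier_def interior_open)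
    then obtain v s g L where c: "norm v = 1" "s > 0" "L-lipschitz_on {z. z \<bullet> v = 0} (g :: 'a \<Rightarrow> real)"
        "\<Omega> \<inter> ball x s = {y \<in> ball x s. y \<bullet> v < g (y - (y \<bullet> v) *\<^sub>R v)}"
      using assms(3) unfolding lipschitz_boundary_def by blast
    have "0 < measure lborel (ball (0 :: 'a) (1 / (4 * (1 + 2 * L))))"
      using lipschitz_on_nonneg[OF c(3)] by (simp add: content_ball)
    then show ?thesis using interior_cone_below_graph[OF c(1,3,4)] c(2) by blast
  qed
  then obtain s b where sb: "\<And>x. x \<in> closure \<Omega> \<Longrightarrow> 0 < s x \<and> 0 < b x \<and>
      (\<forall>z\<in>\<Omega> \<inter> ball x (s x / 2). \<exists>Q. interior_cone \<Omega> (s x) (b x) z Q)"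
    by metis
  have "compact (closure \<Omega>)" using assms(2) by simp
  moreover have "closure \<Omega> \<subseteq> (\<Union>x\<in>closure \<Omega>. ball x (s x / 2))" using sb by force
  ultimately obtain X where X: "X \<subseteq> closure \<Omega>" "finite X" "closure \<Omega> \<subseteq> (\<Union>x\<in>X. ball x (s x / 2))"
    by (elim compactE_image[where f = "\<lambda>x. ball x (s x / 2)"]) auto
  define R where "R = Min (insert 1 (s ` X))"
  define \<beta> where "\<beta> = Min (insert 1 (b ` X))"
  show thesis
  proof (rule that[of R \<beta>])
    show R: "0 < R" and "0 < \<beta>" using X sb by (auto simp: R_def \<beta>_def)
    fix z assume z: "z \<in> \<Omega>"
    then obtain x where x: "x \<in> X" "z \<in> ball x (s x / 2)"
      using X closure_subset by blast
    then obtain Q where "interior_cone \<Omega> (s x) (b x) z Q" using sb X z by blast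
    moreover have "R \<le> s x" "\<beta> \<le> b x" using X x by (auto simp: R_def \<beta>_def)
    ultimately show "\<exists>Q. interior_cone \<Omega> R \<beta> z Q" using R by (meson interior_cone_mono less_imp_le)
  qed
qed


section \<open>The uniform bound\<close>

lemma emeasure_lborel_affine_image:
  fixes Q :: "'a::euclidean_space set"
  assumes "compact Q" "0 < s"
  shows "emeasure lborel ((\<lambda>h. z + s *\<^sub>R h) ` Q) = ennreal (s ^ DIM('a)) * emeasure lborel Q"
proof -
  have [measurable]: "Q \<in> sets borel" "(\<lambda>h. z + s *\<^sub>R h) ` Q \<in> sets borel"
    using assms by (auto intro!: borel_closed compact_imp_closed compact_continuous_image continuous_intros)
  have "emeasure lborel ((\<lambda>h. z + s *\<^sub>R h) ` Q) = (\<integral>\<^sup>+x. indicator ((\<lambda>h. z + s *\<^sub>R h) ` Q) x \<partial>lborel)"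
    by (simp add: nn_integral_indicator)
  also have "\<dots> = ennreal (\<bar>s\<bar> ^ DIM('a)) * (\<integral>\<^sup>+x. indicator ((\<lambda>h. z + s *\<^sub>R h) ` Q) (z + s *\<^sub>R x) \<partial>lborel)"
    using assms by (intro nn_integral_lborel_affine) auto
  also have "(\<lambda>x. indicator ((\<lambda>h. z + s *\<^sub>R h) ` Q) (z + s *\<^sub>R x)) = (indicator Q :: 'a \<Rightarrow> ennreal)"
    using assms by (auto simp: indicator_def fun_eq_iff)
  finally show ?thesis using assms by (simp add: nn_integral_indicator)
qed

lemma mean_le_moment:
  fixes P :: "'a::euclidean_space set"
  assumes [measurable]: "P \<in> sets borel" "g \<in> borel_measurable borel"
    and m: "0 < m" "ennreal m \<le> emeasure lborel P" "emeasure lborel P < \<infinity>"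
    and "0 < h" "1 \<le> p"
    and F: "F \<in> borel_measurable borel" "\<And>y. y \<in> P \<Longrightarrow> ennreal (\<bar>g y\<bar> powr p) \<le> F y"
  shows "(\<integral>\<^sup>+y. ennreal \<bar>g y\<bar> \<partial>uniform_measure lborel P)
    \<le> ennreal h + ennreal (h powr (1 - p) / m) * (\<integral>\<^sup>+y. F y \<partial>lborel)"
proof -
  define U where "U = uniform_measure lborel P"
  have "emeasure lborel P \<noteq> 0"
    using m by (auto simp: ennreal_eq_0_iff)
  then interpret P: prob_space U unfolding U_def using m by (intro prob_space_uniform_measure) auto
  have [simp, measurable_cong]: "sets U = sets borel" by (simp add: U_def)
  note F(1) [measurable]
  have "AE y in U. y \<in> P"
    unfolding U_def by (auto intro!: AE_uniform_measureI)
  then have "AE y in U. ennreal \<bar>g y\<bar> \<le> ennreal h + ennreal (h powr (1 - p)) * F y"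
  proof eventually_elim
    case (elim y)
    have "ennreal \<bar>g y\<bar> \<le> ennreal (h + h powr (1 - p) * \<bar>g y\<bar> powr p)"
      using assms by (intro ennreal_leI le_add_powr) auto
    also have "\<dots> = ennreal h + ennreal (h powr (1 - p)) * ennreal (\<bar>g y\<bar> powr p)"
      using \<open>0 < h\<close> by (simp add: ennreal_mult)
    also have "\<dots> \<le> ennreal h + ennreal (h powr (1 - p)) * F y"
      by (intro add_left_mono mult_left_mono F(2) elim) auto
    finally show ?case .
  qed
  then have "(\<integral>\<^sup>+y. ennreal \<bar>g y\<bar> \<partial>U) \<le> (\<integral>\<^sup>+y. ennreal h + ennreal (h powr (1 - p)) * F y \<partial>U)"
    by (rule nn_integral_mono_AE)
  also have "\<dots> = ennreal h + ennreal (h powr (1 - p)) * (\<integral>\<^sup>+y. F y \<partial>U)"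
    by (simp add: nn_integral_add nn_integral_cmult P.emeasure_space_1)
  also have "\<dots> \<le> ennreal h + ennreal (h powr (1 - p)) * (ennreal (1 / m) * (\<integral>\<^sup>+y. F y \<partial>lborel))"
    unfolding U_def by (intro add_left_mono mult_left_mono nn_integral_uniform_measure_le) (use m in auto)
  also have "ennreal (h powr (1 - p)) * (ennreal (1 / m) * (\<integral>\<^sup>+y. F y \<partial>lborel))
      = ennreal (h powr (1 - p) / m) * (\<integral>\<^sup>+y. F y \<partial>lborel)"
    using m by (simp add: mult.assoc[symmetric] flip: ennreal_mult)
  finally show ?thesis unfolding U_def .
qed

lemma dyadic_scale_exists:
  fixes \<tau> R :: real
  assumes "0 < \<tau>" "\<tau> \<le> R"
  obtains J :: nat where "2 ^ J * \<tau> \<le> R" "R / 2 < 2 ^ J * \<tau>"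
proof -
  define n where "n = (LEAST n. R / \<tau> < 2 ^ n)"
  obtain m where "R / \<tau> < 2 ^ m"
    using real_arch_pow[of 2 "R / \<tau>"] by auto
  then have n: "R / \<tau> < 2 ^ n" unfolding n_def by (rule LeastI)
  have "n \<noteq> 0" using n assms by (intro notI) (simp add: divide_simps)
  then obtain J where J: "n = Suc J" by (cases n) auto
  have "\<not> R / \<tau> < 2 ^ J" using not_less_Least[of J "\<lambda>n. R / \<tau> < 2 ^ n"] J unfolding n_def by simp
  then have "2 ^ J * \<tau> \<le> R" using assms by (simp add: divide_simps)
  moreover have "R / 2 < 2 ^ J * \<tau>" using n assms unfolding J by (simp add: divide_simps)
  ultimately show thesis by (rule that)
qed

text \<open>
  The three summands bound the distance of \<open>f z\<close> to the mean at the finest scale, the mean at the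
  coarsest scale, and the cost of the scales in between.
\<close>
definition sup_const :: "nat \<Rightarrow> real \<Rightarrow> real \<Rightarrow> real \<Rightarrow> real \<Rightarrow> real \<Rightarrow> real \<Rightarrow> real" where
  "sup_const d p B H N R \<beta> = (1 + H / \<beta>) + (1 + N / (\<beta> * (R / 2) ^ d)) + chain_const d p B \<beta> * R powr (1 - real d / p)"

context energy_at_scale
begin

text \<open>
  Morrey's inequality up to the boundary: the dyadic chain of means runs through scaled copies of an
  interior cone with vertex \<open>z\<close>. At the finest scale, where the energy says nothing about the single
  point \<open>z\<close>, the local energy at \<open>z\<close> is assumed to be bounded.
\<close>
lemma sup_bound:
  assumes cone: "interior_cone \<Omega> R \<beta> z Q" and \<beta>: "0 < \<beta>" and \<tau>: "\<tau> \<le> R"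
    and z: "z \<in> \<Omega>"
    and H: "0 \<le> H" "(\<integral>\<^sup>+y. jump \<Omega> \<tau> p f z y \<partial>lborel) \<le> ennreal (H * \<tau> ^ DIM('a))"
    and N: "0 \<le> N" "(\<integral>\<^sup>+y. indicator \<Omega> y * ennreal (\<bar>f y\<bar> powr p) \<partial>lborel) \<le> ennreal N"
  shows "\<bar>f z\<bar> \<le> sup_const DIM('a) p B H N R \<beta>"
proof -
  have R: "0 < R" using scale_pos \<tau> by simp
  obtain J where J: "2 ^ J * \<tau> \<le> R" "R / 2 < 2 ^ J * \<tau>"
    using scale_pos \<tau> by (rule dyadic_scale_exists)
  define P where "P k = (\<lambda>h. z + (2 ^ k * \<tau>) *\<^sub>R h) ` Q" for k :: nat
  have s: "0 < 2 ^ k * \<tau>" for k :: nat using scale_pos by simp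
  have Q: "compact Q" "convex Q" "0 \<in> Q" "Q \<subseteq> cball 0 (1/2)" "ennreal \<beta> \<le> emeasure lborel Q"
    using cone by (auto simp: interior_cone_def)
  have compact_P: "compact (P k)" for k
    unfolding P_def by (intro compact_continuous_image Q continuous_intros)
  then have borel_P [measurable]: "P k \<in> sets borel" for k by (intro borel_closed compact_imp_closed)
  have convex_P: "convex (P k)" for k
    unfolding P_def using convex_affinity[OF Q(2), of z "2 ^ k * \<tau>"] by simp
  have P_sub: "P k \<subseteq> \<Omega>" if "k \<le> J" for k
  proof -
    have "2 ^ k * \<tau> \<le> 2 ^ J * \<tau>" using that scale_pos by (intro mult_right_mono power_increasing) auto
    then have "interior_cone \<Omega> (2 ^ k * \<tau>) \<beta> z Q"
      using J s[of k] by (intro interior_cone_mono[OF cone]) auto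
    then show ?thesis by (auto simp: interior_cone_def P_def)
  qed
  have nested: "P k \<subseteq> P (Suc k)" for k
  proof
    fix y assume "y \<in> P k"
    then obtain h where h: "h \<in> Q" "y = z + (2 ^ k * \<tau>) *\<^sub>R h" by (auto simp: P_def)
    have "(1/2) *\<^sub>R h + (1/2) *\<^sub>R 0 \<in> Q" using h Q by (intro convexD) auto
    then show "y \<in> P (Suc k)" unfolding P_def h by (intro image_eqI[of _ _ "(1/2) *\<^sub>R h"]) auto
  qed
  have dist_z: "dist z y \<le> 2 ^ k * \<tau> / 2" if y: "y \<in> P k" for k y
  proof -
    obtain h where h: "h \<in> Q" "y = z + (2 ^ k * \<tau>) *\<^sub>R h" using y by (auto simp: P_def)
    have "norm h \<le> 1/2" using h Q(4) by auto
    then have "(2 ^ k * \<tau>) * norm h \<le> (2 ^ k * \<tau>) * (1/2)" using s[of k] by (intro mult_left_mono) auto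
    then show ?thesis using scale_pos by (simp add: h dist_norm abs_mult)
  qed
  have diam: "dist x y \<le> 2 ^ k * \<tau>" if "x \<in> P k" "y \<in> P k" for k x y
    using dist_z[OF that(1)] dist_z[OF that(2)] dist_triangle2[of x y z] by (simp add: dist_commute)
  have mass: "ennreal (\<beta> * (2 ^ k * \<tau>) ^ DIM('a)) \<le> emeasure lborel (P k)" for k
  proof -
    have "ennreal (\<beta> * (2 ^ k * \<tau>) ^ DIM('a)) = ennreal ((2 ^ k * \<tau>) ^ DIM('a)) * ennreal \<beta>"
      using \<beta> s[of k] by (simp add: mult.commute flip: ennreal_mult)
    also have "\<dots> \<le> ennreal ((2 ^ k * \<tau>) ^ DIM('a)) * emeasure lborel Q"
      by (intro mult_left_mono Q) auto
    also have "\<dots> = emeasure lborel (P k)"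
      unfolding P_def using Q s by (intro emeasure_lborel_affine_image[symmetric]) auto
    finally show ?thesis .
  qed
  have fin: "emeasure lborel (P k) < \<infinity>" for k
    using compact_P by (intro emeasure_bounded_finite compact_imp_bounded)
  have pos: "0 < \<beta> * (2 ^ k * \<tau>) ^ DIM('a)" for k using \<beta> s[of k] by simp
  define U where "U k = uniform_measure lborel (P k)" for k
  have prob: "prob_space (U k)" for k
    unfolding U_def using mass[of k] fin[of k] pos[of k]
    by (intro prob_space_uniform_measure) (auto simp: ennreal_eq_0_iff simp flip: not_less)
  interpret U0: prob_space "U 0" by (rule prob)
  have [simp, measurable_cong]: "sets (U k) = sets borel" for k by (simp add: U_def)
  let ?K = "chain_const DIM('a) p B \<beta>" and ?a = "1 - real DIM('a) / p"
  have K0: "0 \<le> ?K" using dim_less B_nonneg by (rule chain_const_nonneg)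
  have a0: "0 \<le> ?a" using dim_less p_ge_1 by (simp add: divide_simps)

  have near: "(\<integral>\<^sup>+y. ennreal \<bar>f z - f y\<bar> \<partial>U 0) \<le> ennreal (1 + H / \<beta>)"
  proof -
    have "(\<integral>\<^sup>+y. ennreal \<bar>f z - f y\<bar> \<partial>U 0)
        \<le> ennreal 1 + ennreal (1 powr (1 - p) / (\<beta> * (2 ^ 0 * \<tau>) ^ DIM('a))) * (\<integral>\<^sup>+y. jump \<Omega> \<tau> p f z y \<partial>lborel)"
      unfolding U_def
    proof (rule mean_le_moment)
      show "ennreal (\<bar>f z - f y\<bar> powr p) \<le> jump \<Omega> \<tau> p f z y" if "y \<in> P 0" for y
        using dist_z[OF that] P_sub[of 0] that z scale_pos by (auto simp: jump_def)
    qed (use mass[of 0] fin pos[of 0] p_ge_1 in auto)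
    also have "\<dots> \<le> ennreal 1 + ennreal (1 / (\<beta> * \<tau> ^ DIM('a))) * ennreal (H * \<tau> ^ DIM('a))"
      using H by (intro add_left_mono mult_mono) auto
    also have "\<dots> = ennreal (1 + H / \<beta>)"
      using H \<beta> scale_pos by (subst ennreal_plus) (auto simp flip: ennreal_mult)
    finally show ?thesis .
  qed
  have far: "(\<integral>\<^sup>+y. ennreal \<bar>f y\<bar> \<partial>U J) \<le> ennreal (1 + N / (\<beta> * (R / 2) ^ DIM('a)))"
  proof -
    have "(\<integral>\<^sup>+y. ennreal \<bar>f y\<bar> \<partial>U J)
        \<le> ennreal 1 + ennreal (1 powr (1 - p) / (\<beta> * (2 ^ J * \<tau>) ^ DIM('a))) * (\<integral>\<^sup>+y. indicator \<Omega> y * ennreal (\<bar>f y\<bar> powr p) \<partial>lborel)"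
      unfolding U_def using mass[of J] fin pos[of J] p_ge_1 P_sub[of J]
      by (intro mean_le_moment) (auto simp: indicator_def)
    also have "\<dots> \<le> ennreal 1 + ennreal (1 / (\<beta> * (R / 2) ^ DIM('a))) * ennreal N"
      using N \<beta> R J s[of J] pos[of J]
      by (intro add_left_mono mult_mono ennreal_leI) (auto intro!: divide_left_mono mult_left_mono power_mono mult_pos_pos)
    also have "\<dots> = ennreal (1 + N / (\<beta> * (R / 2) ^ DIM('a)))"
      using N \<beta> R by (subst ennreal_plus) (auto simp flip: ennreal_mult)
    finally show ?thesis .
  qed
  have "ennreal \<bar>f z\<bar> = (\<integral>\<^sup>+y. ennreal \<bar>f z\<bar> \<partial>U 0)" by (simp add: U0.emeasure_space_1)
  also have "\<dots> \<le> (\<integral>\<^sup>+y. ennreal \<bar>f z - f y\<bar> + ennreal \<bar>f y - 0\<bar> \<partial>U 0)"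
    by (intro nn_integral_mono) (auto simp flip: ennreal_plus intro!: ennreal_leI)
  also have "\<dots> = (\<integral>\<^sup>+y. ennreal \<bar>f z - f y\<bar> \<partial>U 0) + (\<integral>\<^sup>+y. ennreal \<bar>f y - 0\<bar> \<partial>U 0)"
    by (rule nn_integral_add) measurable
  also have "\<dots> \<le> ennreal (1 + H / \<beta>) + ((\<integral>\<^sup>+y. ennreal \<bar>f y - 0\<bar> \<partial>U J) + ennreal (?K * (2 ^ J * \<tau>) powr ?a))"
    unfolding U_def
    by (intro add_mono near[unfolded U_def] mean_deviation_chain)
       (use convex_P P_sub nested diam \<beta> mass fin in auto)
  also have "\<dots> \<le> ennreal (1 + H / \<beta>) + (ennreal (1 + N / (\<beta> * (R / 2) ^ DIM('a))) + ennreal (?K * R powr ?a))"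
    using far J s[of J] K0 a0 by (intro add_mono ennreal_leI mult_left_mono powr_mono2) auto
  also have "\<dots> = ennreal (sup_const DIM('a) p B H N R \<beta>)"
    using H N \<beta> R K0 by (simp add: sup_const_def add.assoc flip: ennreal_plus)
  finally show ?thesis
    using H N \<beta> R K0 by (subst (asm) ennreal_le_iff) (auto simp: sup_const_def)
qed

end


section \<open>Approximate Hoelder continuity in the interior\<close>

abbreviation half_ball_const :: "'a::euclidean_space itself \<Rightarrow> real" where
  "half_ball_const _ \<equiv> unit_ball_vol (real DIM('a)) / 2 ^ DIM('a)"

lemma emeasure_half_ball:
  fixes x :: "'a::euclidean_space"
  assumes "0 \<le> r"
  shows "emeasure lborel (cball x (r / 2)) = ennreal (half_ball_const TYPE('a) * r ^ DIM('a))"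
  using assms by (simp add: emeasure_cball power_divide)

lemma half_ball_const_pos: "0 < half_ball_const TYPE('a::euclidean_space)"
  by simp

context energy_at_scale
begin

definition near_mean :: "'a \<Rightarrow> ennreal" where
  "near_mean x = (\<integral>\<^sup>+y. ennreal \<bar>f y - f x\<bar> \<partial>uniform_measure lborel (cball x (\<tau> / 2)))"

text \<open>
  Two chains of concentric balls, around \<open>x\<close> and around \<open>q\<close>, are linked at a scale comparable with the
  distance of the two points. The terms \<open>near_mean\<close> account for the uncontrolled oscillation below
  the scale \<open>\<tau>\<close>.
\<close>
lemma holder_interior:
  assumes sub: "cball x (2 ^ J * \<tau>) \<subseteq> \<Omega>" and q: "dist x q \<le> 2 ^ J * \<tau> / 2"
  shows "ennreal \<bar>f x - f q\<bar> \<le> near_mean x + near_mean q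
    + ennreal (2 * chain_const DIM('a) p B (half_ball_const TYPE('a)) * (2 * (2 ^ J * \<tau>)) powr (1 - real DIM('a) / p))"
proof -
  define b where "b = half_ball_const TYPE('a)"
  have b: "0 < b" unfolding b_def by (rule half_ball_const_pos)
  define \<rho> where "\<rho> = 2 ^ J * \<tau>"
  let ?K = "chain_const DIM('a) p B b" and ?a = "1 - real DIM('a) / p" and ?G = "gap_const B (b / 2 ^ DIM('a))"
  have \<rho>: "0 < \<rho>" using scale_pos by (simp add: \<rho>_def)
  have s: "0 < 2 ^ k * \<tau>" for k :: nat using scale_pos by simp
  have K0: "0 \<le> ?K" using dim_less B_nonneg by (rule chain_const_nonneg)
  have G0: "0 \<le> ?G" using B_nonneg by (simp add: gap_const_def)
  have mass: "emeasure lborel (cball w (2 ^ k * \<tau> / 2)) = ennreal (b * (2 ^ k * \<tau>) ^ DIM('a))" for w :: 'a and k :: nat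
    unfolding b_def using s[of k] by (intro emeasure_half_ball) simp
  define U where "U w k = uniform_measure lborel (cball w (2 ^ k * \<tau> / 2))" for w :: 'a and k :: nat
  have prob: "prob_space (U w k)" for w k
    unfolding U_def mass using b s[of k] by (intro prob_space_uniform_measure) (auto simp: mass ennreal_eq_0_iff not_le)
  have emU: "emeasure (U w k) (space (U w k)) = 1" for w k
    using prob_space.emeasure_space_1[OF prob] .
  have sigma: "sigma_finite_measure (U w k)" for w k
    using prob[of w k] by (simp add: prob_space_imp_sigma_finite)
  have [simp, measurable_cong]: "sets (U w k) = sets borel" for w k by (simp add: U_def)
  have ball_sub: "cball w (\<rho> / 2) \<subseteq> cball x \<rho>" if "dist x w \<le> \<rho> / 2" for w
  proof
    fix y assume "y \<in> cball w (\<rho> / 2)"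
    then show "y \<in> cball x \<rho>" using that dist_triangle[of x y w] by simp
  qed
  have chain: "(\<integral>\<^sup>+y. ennreal \<bar>f y - c\<bar> \<partial>U w 0)
      \<le> (\<integral>\<^sup>+y. ennreal \<bar>f y - c\<bar> \<partial>U w J) + ennreal (?K * \<rho> powr ?a)"
    if w: "dist x w \<le> \<rho> / 2" for w c
    unfolding U_def \<rho>_def
  proof (rule mean_deviation_chain)
    fix k assume k: "k \<le> J"
    have "2 ^ k * \<tau> \<le> \<rho>" unfolding \<rho>_def using k scale_pos by (intro mult_right_mono power_increasing) auto
    then have "cball w (2 ^ k * \<tau> / 2) \<subseteq> cball w (\<rho> / 2)" by auto
    also have "\<dots> \<subseteq> \<Omega>" using ball_sub[OF w] sub by (simp add: \<rho>_def)
    finally show "convex (cball w (2 ^ k * \<tau> / 2)) \<and> cball w (2 ^ k * \<tau> / 2) \<in> sets borel \<and> cball w (2 ^ k * \<tau> / 2) \<subseteq> \<Omega>"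
      by simp
  next
    fix k :: nat and u v assume "u \<in> cball w (2 ^ k * \<tau> / 2)" "v \<in> cball w (2 ^ k * \<tau> / 2)"
    then show "dist u v \<le> 2 ^ k * \<tau>" using dist_triangle3[of u v w] by simp
  next
    fix k :: nat
    show "cball w (2 ^ k * \<tau> / 2) \<subseteq> cball w (2 ^ Suc k * \<tau> / 2)"
      using scale_pos by (intro subset_cball) simp
  qed (use b s mass in \<open>auto simp: emeasure_cball\<close>)
  have gap: "(\<integral>\<^sup>+y. \<integral>\<^sup>+w. ennreal \<bar>f y - f w\<bar> \<partial>U q J \<partial>U x J) \<le> ennreal (?G * (2 * \<rho>) powr ?a)"
  proof -
    have "(\<integral>\<^sup>+y. \<integral>\<^sup>+w. ennreal \<bar>f y - f w\<bar> \<partial>U q J \<partial>U x J)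
        \<le> ennreal (?G * (2 ^ Suc J * \<tau>) powr ?a)"
      unfolding U_def
    proof (rule mean_gap_at_scale[where C = "cball x \<rho>"])
      show "cball x (2 ^ J * \<tau> / 2) \<subseteq> cball x \<rho>" "cball q (2 ^ J * \<tau> / 2) \<subseteq> cball x \<rho>"
        using ball_sub[of x] ball_sub[of q] q \<rho> by (auto simp: \<rho>_def)
      show "dist u v \<le> 2 ^ Suc J * \<tau>" if "u \<in> cball x \<rho>" "v \<in> cball x \<rho>" for u v
        using that dist_triangle3[of u v x] by (simp add: \<rho>_def)
      have "b / 2 ^ DIM('a) * (2 ^ Suc J * \<tau>) ^ DIM('a) = b * (2 ^ J * \<tau>) ^ DIM('a)"
        by (simp add: power_mult_distrib)
      then show "ennreal (b / 2 ^ DIM('a) * (2 ^ Suc J * \<tau>) ^ DIM('a)) \<le> emeasure lborel (cball x (2 ^ J * \<tau> / 2))"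
        "ennreal (b / 2 ^ DIM('a) * (2 ^ Suc J * \<tau>) ^ DIM('a)) \<le> emeasure lborel (cball q (2 ^ J * \<tau> / 2))"
        by (simp_all add: mass)
    qed (use sub b mass in \<open>auto simp: \<rho>_def\<close>)
    then show ?thesis by (simp add: \<rho>_def mult.assoc)
  qed
  have near: "near_mean w = (\<integral>\<^sup>+y. ennreal \<bar>f y - f w\<bar> \<partial>U w 0)" for w
    by (simp add: near_mean_def U_def)
  \<comment> \<open>The triangle inequality for the distance of a constant to a mean.\<close>
  have tri: "ennreal \<bar>f w - c\<bar> \<le> near_mean w + (\<integral>\<^sup>+y. ennreal \<bar>f y - c\<bar> \<partial>U w 0)" for w c
  proof -
    have "ennreal \<bar>f w - c\<bar> = (\<integral>\<^sup>+y. ennreal \<bar>f w - c\<bar> \<partial>U w 0)" by (simp add: emU)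
    also have "\<dots> \<le> (\<integral>\<^sup>+y. ennreal \<bar>f y - f w\<bar> + ennreal \<bar>f y - c\<bar> \<partial>U w 0)"
      by (intro nn_integral_mono) (auto simp flip: ennreal_plus intro!: ennreal_leI)
    also have "\<dots> = near_mean w + (\<integral>\<^sup>+y. ennreal \<bar>f y - c\<bar> \<partial>U w 0)"
      unfolding near by (rule nn_integral_add) measurable
    finally show ?thesis .
  qed
  interpret Uq: sigma_finite_measure "U q J" by (rule sigma)
  have inner: "ennreal \<bar>f y - f q\<bar> \<le> near_mean q + ((\<integral>\<^sup>+w. ennreal \<bar>f y - f w\<bar> \<partial>U q J) + ennreal (?K * \<rho> powr ?a))" for y
  proof -
    have "ennreal \<bar>f q - f y\<bar> \<le> near_mean q + (\<integral>\<^sup>+w. ennreal \<bar>f w - f y\<bar> \<partial>U q 0)" by (rule tri)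
    also have "\<dots> \<le> near_mean q + ((\<integral>\<^sup>+w. ennreal \<bar>f w - f y\<bar> \<partial>U q J) + ennreal (?K * \<rho> powr ?a))"
      using q by (intro add_left_mono chain) (simp add: \<rho>_def)
    finally show ?thesis by (simp add: abs_minus_commute)
  qed
  have "ennreal \<bar>f x - f q\<bar> \<le> near_mean x + (\<integral>\<^sup>+y. ennreal \<bar>f y - f q\<bar> \<partial>U x 0)" by (rule tri)
  also have "\<dots> \<le> near_mean x + ((\<integral>\<^sup>+y. ennreal \<bar>f y - f q\<bar> \<partial>U x J) + ennreal (?K * \<rho> powr ?a))"
    using \<rho> by (intro add_left_mono chain) simp
  also have "(\<integral>\<^sup>+y. ennreal \<bar>f y - f q\<bar> \<partial>U x J)
      \<le> (\<integral>\<^sup>+y. near_mean q + ((\<integral>\<^sup>+w. ennreal \<bar>f y - f w\<bar> \<partial>U q J) + ennreal (?K * \<rho> powr ?a)) \<partial>U x J)"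
    by (intro nn_integral_mono inner)
  also have "\<dots> = near_mean q + ((\<integral>\<^sup>+y. \<integral>\<^sup>+w. ennreal \<bar>f y - f w\<bar> \<partial>U q J \<partial>U x J) + ennreal (?K * \<rho> powr ?a))"
    by (simp add: nn_integral_add emU)
  also have "\<dots> \<le> near_mean q + (ennreal (?G * (2 * \<rho>) powr ?a) + ennreal (?K * \<rho> powr ?a))"
    by (intro add_left_mono add_right_mono gap)
  also have "ennreal (?G * (2 * \<rho>) powr ?a) + ennreal (?K * \<rho> powr ?a) = ennreal (?K * (2 * \<rho>) powr ?a)"
    using chain_const_step[of "DIM('a)" p \<rho> B b] dim_less \<rho> K0 G0 by (simp flip: ennreal_plus)
  also have "near_mean x + (near_mean q + ennreal (?K * (2 * \<rho>) powr ?a) + ennreal (?K * \<rho> powr ?a))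
      \<le> near_mean x + (near_mean q + ennreal (?K * (2 * \<rho>) powr ?a) + ennreal (?K * (2 * \<rho>) powr ?a))"
    using \<rho> K0 dim_less p_ge_1 by (intro add_left_mono ennreal_leI mult_left_mono powr_mono2) (auto simp: divide_simps)
  also have "\<dots> = near_mean x + near_mean q + ennreal (2 * ?K * (2 * \<rho>) powr ?a)"
    using K0 by (simp add: add.assoc mult.assoc flip: ennreal_plus)
  finally show ?thesis by (simp add: add_left_mono \<rho>_def b_def)
qed

lemma near_mean_le:
  assumes "cball x (\<tau> / 2) \<subseteq> \<Omega>" "0 < h"
  shows "near_mean x \<le> ennreal h
    + ennreal (h powr (1 - p) / (half_ball_const TYPE('a) * \<tau> ^ DIM('a))) * (\<integral>\<^sup>+y. jump \<Omega> \<tau> p f x y \<partial>lborel)"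
  unfolding near_mean_def
proof (rule mean_le_moment)
  fix y assume "y \<in> cball x (\<tau> / 2)"
  then show "ennreal (\<bar>f y - f x\<bar> powr p) \<le> jump \<Omega> \<tau> p f x y"
    using assms scale_pos by (auto simp: jump_def abs_minus_commute subset_eq)
qed (use assms p_ge_1 scale_pos emeasure_half_ball[of \<tau> x] in \<open>auto simp: emeasure_cball\<close>)

end


section \<open>Almost everywhere convergent subsequences\<close>

text \<open>
  The local energies, divided by \<open>\<tau> n ^ d\<close>, tend to 0 in \<open>L\<^sup>1\<close>, hence almost everywhere along a
  subsequence. On the resulting set of full measure the functions satisfy a common Hoelder estimate up to
  an error that vanishes in the limit. Convergence on a countable dense subset, arranged by a
  diagonal argument, then spreads to the whole set as in the Arzela--Ascoli theorem.
\<close>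
theorem subsequence_converges_AE:
  fixes \<Omega> :: "'a::euclidean_space set" and f :: "nat \<Rightarrow> 'a \<Rightarrow> real"
  assumes \<Omega>: "open \<Omega>" "bounded \<Omega>"
    and scale: "\<And>n. energy_at_scale \<Omega> (f n) p (\<tau> n) B" and \<tau>: "\<tau> \<longlonglongrightarrow> 0"
    and M: "\<And>n x. x \<in> \<Omega> \<Longrightarrow> \<bar>f n x\<bar> \<le> M"
  obtains l where "strict_mono (l :: nat \<Rightarrow> nat)"
    "AE x in lborel. x \<in> \<Omega> \<longrightarrow> convergent (\<lambda>n. f (l n) x)"
proof -
  interpret E: energy_at_scale \<Omega> "f n" p "\<tau> n" B for n by (rule scale)
  have f_borel [measurable]: "f n \<in> borel_measurable borel" for n by (rule E.f_borel)
  define G where "G n x = (\<integral>\<^sup>+y. jump \<Omega> (\<tau> n) p (f n) x y \<partial>lborel)" for n x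
  have G_borel [measurable]: "G n \<in> borel_measurable borel" for n
    unfolding G_def by measurable
  have jeG: "jump_energy \<Omega> (\<tau> n) p (f n) = (\<integral>\<^sup>+x. G n x \<partial>lborel)" for n
    unfolding jump_energy_def G_def ..
  have vol: "emeasure lborel \<Omega> < \<infinity>" using \<Omega> by (intro emeasure_bounded_finite)
  have G_fin: "G n x < \<infinity>" for n x
  proof -
    have "jump \<Omega> (\<tau> n) p (f n) x y \<le> ennreal ((2 * M) powr p) * indicator \<Omega> y" for y
    proof (cases "x \<in> \<Omega> \<and> y \<in> \<Omega>")
      case True
      then have "\<bar>f n x - f n y\<bar> \<le> 2 * M" using M[of x n] M[of y n] by (auto simp: abs_le_iff)
      then have "\<bar>f n x - f n y\<bar> powr p \<le> (2 * M) powr p"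
        using E.p_ge_1 by (intro powr_mono2) auto
      then show ?thesis using True by (simp add: jump_def ennreal_leI)
    qed (auto simp: jump_def)
    then have "G n x \<le> (\<integral>\<^sup>+y. ennreal ((2 * M) powr p) * indicator \<Omega> y \<partial>lborel)"
      unfolding G_def by (intro nn_integral_mono)
    also have "\<dots> = ennreal ((2 * M) powr p) * emeasure lborel \<Omega>" by (simp add: nn_integral_cmult_indicator)
    also have "\<dots> < \<infinity>" using vol by (simp add: ennreal_mult_less_top)
    finally show ?thesis .
  qed
  \<comment> \<open>The local energy normalised by the volume of the scale, which is finite as \<open>f n\<close> is bounded.\<close>
  define g where "g n x = enn2real (G n x) / \<tau> n ^ DIM('a)" for n x
  have G_g: "G n x = ennreal (g n x * \<tau> n ^ DIM('a))" for n x
    using G_fin[of n x] E.scale_pos[of n] by (simp add: g_def less_top)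
  have g_nonneg: "0 \<le> g n x" for n x using E.scale_pos[of n] by (simp add: g_def)
  have g_borel [measurable]: "g n \<in> borel_measurable borel" for n unfolding g_def by measurable
  have int_g: "(\<integral>\<^sup>+x. ennreal (g n x) \<partial>lborel) \<le> ennreal (B * \<tau> n powr p)" for n
  proof -
    have t: "0 < \<tau> n ^ DIM('a)" using E.scale_pos[of n] by simp
    have "(\<integral>\<^sup>+x. ennreal (g n x) \<partial>lborel) = (\<integral>\<^sup>+x. ennreal (1 / \<tau> n ^ DIM('a)) * G n x \<partial>lborel)"
      using E.scale_pos[of n] g_nonneg by (intro nn_integral_cong) (simp add: G_g flip: ennreal_mult)
    also have "\<dots> = ennreal (1 / \<tau> n ^ DIM('a)) * jump_energy \<Omega> (\<tau> n) p (f n)"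
      unfolding jeG by (rule nn_integral_cmult) measurable
    also have "\<dots> \<le> ennreal (1 / \<tau> n ^ DIM('a)) * ennreal (B * \<tau> n powr (p + real DIM('a)))"
      by (intro mult_left_mono E.energy_le) auto
    also have "\<dots> = ennreal (B * \<tau> n powr p)"
      using t E.scale_pos[of n] E.B_nonneg by (simp add: powr_add powr_realpow flip: ennreal_mult)
    finally show ?thesis .
  qed
  have g_int: "integrable lborel (g n)" for n
    using int_g[of n] g_nonneg by (intro integrableI_bounded) (auto intro: le_less_trans)
  have p0: "0 < p" using E.p_ge_1 by simp
  have "(\<lambda>n. \<integral>x. norm (g n x) \<partial>lborel) \<longlonglongrightarrow> 0"
  proof (rule tendsto_sandwich[OF _ _ tendsto_const])
    show "\<forall>\<^sub>F n in sequentially. 0 \<le> (\<integral>x. norm (g n x) \<partial>lborel)" by simp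
    have "(\<integral>x. norm (g n x) \<partial>lborel) \<le> B * \<tau> n powr p" for n
    proof -
      have "ennreal (\<integral>x. norm (g n x) \<partial>lborel) = (\<integral>\<^sup>+x. ennreal (g n x) \<partial>lborel)"
        using g_int[of n] g_nonneg by (subst nn_integral_eq_integral[symmetric]) auto
      then show ?thesis using int_g[of n] E.B_nonneg
        by (metis ennreal_le_iff mult_nonneg_nonneg powr_ge_zero)
    qed
    then show "\<forall>\<^sub>F n in sequentially. (\<integral>x. norm (g n x) \<partial>lborel) \<le> B * \<tau> n powr p" by simp
    have "(\<lambda>n. B * \<tau> n powr p) \<longlonglongrightarrow> B * 0"
      using \<tau> p0 E.scale_pos by (intro tendsto_mult tendsto_const tendsto_zero_powrI[OF \<tau> tendsto_const])
         (auto intro!: always_eventually less_imp_le)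
    then show "(\<lambda>n. B * \<tau> n powr p) \<longlonglongrightarrow> 0" by simp
  qed
  then obtain r :: "nat \<Rightarrow> nat" where r: "strict_mono r" "AE x in lborel. (\<lambda>n. g (r n) x) \<longlonglongrightarrow> 0"
    using tendsto_L1_AE_subseq[of lborel g] g_int by blast
  define \<Omega>' where "\<Omega>' = {x \<in> \<Omega>. (\<lambda>n. g (r n) x) \<longlonglongrightarrow> 0}"
  obtain D where D: "countable D" "D \<subseteq> \<Omega>'" "\<Omega>' \<subseteq> closure D" by (rule separable)
  obtain s where s: "strict_mono (s :: nat \<Rightarrow> nat)" "\<And>q. q \<in> D \<Longrightarrow> \<exists>a. (\<lambda>n. f (r (s n)) q) \<longlonglongrightarrow> a"
    by (rule function_convergent_subsequence[OF D(1), of "\<lambda>n. f (r n)" M])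
       (use D M in \<open>auto simp: \<Omega>'_def\<close>)
  define l where "l = r \<circ> s"
  have l: "strict_mono l" unfolding l_def using r(1) s(1) by (rule strict_mono_o)
  have \<tau>l: "(\<lambda>n. \<tau> (l n)) \<longlonglongrightarrow> 0"
    using LIMSEQ_subseq_LIMSEQ[OF \<tau> l] by (simp add: o_def)
  have gl: "(\<lambda>n. g (l n) x) \<longlonglongrightarrow> 0" if "x \<in> \<Omega>'" for x
    using that LIMSEQ_subseq_LIMSEQ[OF _ s(1), of "\<lambda>n. g (r n) x"] by (simp add: \<Omega>'_def l_def o_def)
  define b where "b = half_ball_const TYPE('a)"
  have b: "0 < b" unfolding b_def by (rule half_ball_const_pos)

  have near: "\<forall>\<^sub>F n in sequentially. E.near_mean (l n) x \<le> ennreal e" if x: "x \<in> \<Omega>'" and e: "0 < e" for x e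
  proof -
    obtain d where d: "0 < d" "cball x d \<subseteq> \<Omega>"
      using x \<Omega>(1) by (auto simp: \<Omega>'_def open_contains_cball)
    have "\<forall>\<^sub>F n in sequentially. \<tau> (l n) < d" using \<tau>l d(1) by (rule order_tendstoD)
    moreover have "(\<lambda>n. e / 2 + (e / 2) powr (1 - p) / b * g (l n) x) \<longlonglongrightarrow> e / 2 + (e / 2) powr (1 - p) / b * 0"
      by (intro tendsto_intros gl x)
    then have "\<forall>\<^sub>F n in sequentially. e / 2 + (e / 2) powr (1 - p) / b * g (l n) x < e"
      by (rule order_tendstoD) (use e in simp)
    ultimately show ?thesis
    proof eventually_elim
      case (elim n)
      have t: "0 < \<tau> (l n)" by (rule E.scale_pos)
      have "cball x (\<tau> (l n) / 2) \<subseteq> cball x d" using elim t by auto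
      then have "E.near_mean (l n) x \<le> ennreal (e / 2)
          + ennreal ((e / 2) powr (1 - p) / (b * \<tau> (l n) ^ DIM('a))) * G (l n) x"
        unfolding b_def G_def using d e by (intro E.near_mean_le) auto
      also have "\<dots> = ennreal (e / 2 + (e / 2) powr (1 - p) / b * g (l n) x)"
        unfolding G_g using t b e g_nonneg[of "l n" x] by (simp flip: ennreal_mult ennreal_plus)
      also have "\<dots> \<le> ennreal e" using elim by (intro ennreal_leI) simp
      finally show ?case .
    qed
  qed

  define a where "a = 1 - real DIM('a) / p"
  have a: "0 < a" using E.dim_less p0 by (simp add: a_def divide_simps)
  define K where "K = 2 * chain_const DIM('a) p B b"
  have K: "0 \<le> K" unfolding K_def using chain_const_nonneg[OF E.dim_less E.B_nonneg] by simp
  have "convergent (\<lambda>n. f (l n) x)" if x: "x \<in> \<Omega>'" for x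
  proof -
    have "Cauchy (\<lambda>n. f (l n) x)"
    proof (rule metric_CauchyI)
      fix e :: real assume e: "0 < e"
      obtain d0 where d0: "0 < d0" "cball x d0 \<subseteq> \<Omega>"
        using x \<Omega>(1) by (auto simp: \<Omega>'_def open_contains_cball)
      have "((\<lambda>d. K * (2 * d) powr a) \<longlongrightarrow> K * (2 * 0) powr a) (at_right 0)"
        by (intro tendsto_intros tendsto_powr2) (use a in \<open>auto simp: eventually_at_right_less eventually_at_filter\<close>)
      then have "\<forall>\<^sub>F d in at_right 0. K * (2 * d) powr a < e / 8"
        by (rule order_tendstoD) (use e a in simp)
      moreover have "\<forall>\<^sub>F d in at_right (0::real). d \<in> {0<..<d0}" using d0 by (intro eventually_at_right_real)
      ultimately have "\<forall>\<^sub>F d in at_right 0. K * (2 * d) powr a < e / 8 \<and> d \<in> {0<..<d0}"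
        by (rule eventually_conj)
      then obtain d where d: "K * (2 * d) powr a < e / 8" "0 < d" "d < d0"
        by (auto dest!: eventually_happens)
      obtain q where q: "q \<in> D" "dist q x < d / 4"
        using D(3) x d(2) closure_approachable[of x D] by (auto dest!: spec[of _ "d / 4"])
      have q': "q \<in> \<Omega>'" using q D by auto
      obtain c where "(\<lambda>n. f (l n) q) \<longlonglongrightarrow> c" using s(2)[OF q(1)] by (auto simp: l_def)
      then have "Cauchy (\<lambda>n. f (l n) q)" by (intro convergent_Cauchy convergentI)
      moreover have "0 < e / 4" using e by simp
      ultimately obtain N1 where N1: "\<And>m n. m \<ge> N1 \<Longrightarrow> n \<ge> N1 \<Longrightarrow> dist (f (l m) q) (f (l n) q) < e / 4"
        by (blast dest: metric_CauchyD)
      have e8: "0 < e / 8" using e by simp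
      \<comment> \<open>Three errors of at most \<open>e / 8\<close>: the finest scale at \<open>x\<close>, the finest scale at \<open>q\<close>, and the chain.\<close>
      have "\<forall>\<^sub>F n in sequentially. \<bar>f (l n) x - f (l n) q\<bar> \<le> 3 * (e / 8)"
        using near[OF x e8] near[OF q' e8] order_tendstoD(2)[OF \<tau>l d(2)]
      proof eventually_elim
        case (elim n)
        obtain J where J: "2 ^ J * \<tau> (l n) \<le> d" "d / 2 < 2 ^ J * \<tau> (l n)"
          using dyadic_scale_exists[OF E.scale_pos[of "l n"], of d] elim by auto
        have "cball x (2 ^ J * \<tau> (l n)) \<subseteq> \<Omega>" using J d d0 by auto
        then have "ennreal \<bar>f (l n) x - f (l n) q\<bar> \<le> E.near_mean (l n) x + E.near_mean (l n) q
            + ennreal (K * (2 * (2 ^ J * \<tau> (l n))) powr a)"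
          unfolding K_def b_def a_def using J q by (intro E.holder_interior) (auto simp: dist_commute)
        also have "\<dots> \<le> ennreal (e / 8) + ennreal (e / 8) + ennreal (e / 8)"
        proof (intro add_mono elim ennreal_leI)
          have "K * (2 * (2 ^ J * \<tau> (l n))) powr a \<le> K * (2 * d) powr a"
            using J K a E.scale_pos[of "l n"] by (intro mult_left_mono powr_mono2) auto
          then show "K * (2 * (2 ^ J * \<tau> (l n))) powr a \<le> e / 8" using d by simp
        qed
        also have "\<dots> = ennreal (3 * (e / 8))" using e by (simp flip: ennreal_plus)
        finally show ?case using e by (subst (asm) ennreal_le_iff) auto
      qed
      then obtain N2 where N2: "\<And>n. n \<ge> N2 \<Longrightarrow> \<bar>f (l n) x - f (l n) q\<bar> \<le> 3 * (e / 8)"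
        by (auto simp: eventually_sequentially)
      have "dist (f (l m) x) (f (l n) x) < e" if "m \<ge> max N1 N2" "n \<ge> max N1 N2" for m n
      proof -
        have "dist (f (l m) q) (f (l n) q) < e / 4" "\<bar>f (l m) x - f (l m) q\<bar> \<le> 3 * (e / 8)"
          "\<bar>f (l n) x - f (l n) q\<bar> \<le> 3 * (e / 8)"
          using N1 N2 that by simp_all
        then show ?thesis unfolding dist_real_def by linarith
      qed
      then show "\<exists>N. \<forall>m\<ge>N. \<forall>n\<ge>N. dist (f (l m) x) (f (l n) x) < e" by blast
    qed
    then show ?thesis by (simp add: Cauchy_convergent_iff)
  qed
  moreover have "AE x in lborel. x \<in> \<Omega> \<longrightarrow> x \<in> \<Omega>'"
    using r(2) by eventually_elim (simp add: \<Omega>'_def)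
  ultimately have "AE x in lborel. x \<in> \<Omega> \<longrightarrow> convergent (\<lambda>n. f (l n) x)"
    by (auto elim!: eventually_mono)
  with l show thesis by (rule that)
qed


section \<open>Pulling back graph functions\<close>

text \<open>
  The function \<open>u \<circ> T\<close> on \<open>\<Omega>\<close>; the value 0 outside makes it a Borel function on the whole space.
\<close>
definition pull_back :: "'a set \<Rightarrow> ('a \<Rightarrow> 'a) \<Rightarrow> ('a \<Rightarrow> real) \<Rightarrow> 'a \<Rightarrow> real" where
  "pull_back \<Omega> T u x = (if x \<in> \<Omega> then u (T x) else 0)"

text \<open>The unnormalised contribution of a vertex \<open>z\<close> to the energy of a graph with edges up to length \<open>\<delta>\<close>.\<close>
definition edge_sum :: "'a::euclidean_space set \<Rightarrow> 'a measure \<Rightarrow> real \<Rightarrow> real \<Rightarrow> ('a \<Rightarrow> real) \<Rightarrow> 'a \<Rightarrow> real" where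
  "edge_sum V \<nu> \<delta> p u z =
     (\<Sum>w\<in>V. (if dist z w \<le> \<delta> then \<bar>u z - u w\<bar> powr p else 0) * measure \<nu> {w})"

lemma edge_sum_nonneg: "0 \<le> edge_sum V \<nu> \<delta> p u z"
  unfolding edge_sum_def by (intro sum_nonneg) auto

text \<open>
  Near 0 the kernel dominates a multiple of the indicator function of \<open>{0..s0}\<close>, for which the graph
  energy is a sum over the edges up to length \<open>s0 * \<epsilon>\<close>.
\<close>
lemma sum_edge_sum_le_graph_energy:
  fixes V :: "'a::euclidean_space set"
  assumes "finite V" and \<epsilon>: "0 < \<epsilon>" and c: "0 < c"
    and kernel: "\<And>s. 0 \<le> s \<Longrightarrow> 0 \<le> \<eta> s" "\<And>s. 0 \<le> s \<Longrightarrow> s \<le> s0 \<Longrightarrow> c \<le> \<eta> s"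
  shows "(\<Sum>z\<in>V. edge_sum V \<nu> (s0 * \<epsilon>) p u z * measure \<nu> {z})
    \<le> \<epsilon> powr (p + real DIM('a)) / c * graph_energy \<eta> p \<epsilon> V \<nu> u"
proof -
  have pw: "(if dist z w \<le> s0 * \<epsilon> then \<bar>u z - u w\<bar> powr p else 0)
      \<le> \<epsilon> ^ DIM('a) / c * (rescaled_kernel DIM('a) \<eta> \<epsilon> (norm (z - w)) * \<bar>u z - u w\<bar> powr p)" for z w :: 'a
  proof (cases "dist z w \<le> s0 * \<epsilon>")
    case True
    then have "c \<le> \<eta> (norm (z - w) / \<epsilon>)"
      using \<epsilon> by (intro kernel(2)) (auto simp: dist_norm divide_simps)
    then have "\<bar>u z - u w\<bar> powr p \<le> \<eta> (norm (z - w) / \<epsilon>) / c * \<bar>u z - u w\<bar> powr p"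
      using c mult_right_mono[of 1 "\<eta> (norm (z - w) / \<epsilon>) / c" "\<bar>u z - u w\<bar> powr p"]
      by (simp add: divide_simps)
    then show ?thesis using True \<epsilon> by (simp add: rescaled_kernel_def)
  next
    case False
    have "0 \<le> \<eta> (norm (z - w) / \<epsilon>)" using \<epsilon> by (intro kernel(1)) simp
    then show ?thesis using False \<epsilon> c by (simp add: rescaled_kernel_def)
  qed
  have "(\<Sum>z\<in>V. edge_sum V \<nu> (s0 * \<epsilon>) p u z * measure \<nu> {z})
      \<le> (\<Sum>z\<in>V. (\<Sum>w\<in>V. \<epsilon> ^ DIM('a) / c * (rescaled_kernel DIM('a) \<eta> \<epsilon> (norm (z - w)) * \<bar>u z - u w\<bar> powr p) * measure \<nu> {w}) * measure \<nu> {z})"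
    unfolding edge_sum_def by (intro sum_mono mult_right_mono pw) auto
  also have "\<dots> = \<epsilon> ^ DIM('a) / c * (\<Sum>z\<in>V. \<Sum>w\<in>V. rescaled_kernel DIM('a) \<eta> \<epsilon> (norm (z - w)) * \<bar>u z - u w\<bar> powr p
                          * measure \<nu> {z} * measure \<nu> {w})"
    by (simp add: sum_distrib_left sum_distrib_right ac_simps)
  also have "\<dots> = \<epsilon> powr (p + real DIM('a)) / c * graph_energy \<eta> p \<epsilon> V \<nu> u"
    using \<epsilon> by (simp add: graph_energy_def powr_add powr_realpow)
  finally show ?thesis .
qed

text \<open>
  The total energy controls a single vertex only at the price of its mass, which is why vertices of
  very small mass have to be excluded.
\<close>
lemma edge_sum_le:
  assumes "finite V" "z \<in> V" and tot: "(\<Sum>z\<in>V. edge_sum V \<nu> \<delta> p u z * measure \<nu> {z}) \<le> A"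
    and L: "0 < L" "L \<le> measure \<nu> {z}"
  shows "edge_sum V \<nu> \<delta> p u z \<le> A / L"
proof -
  have "edge_sum V \<nu> \<delta> p u z * L \<le> edge_sum V \<nu> \<delta> p u z * measure \<nu> {z}"
    using L by (intro mult_left_mono edge_sum_nonneg)
  also have "\<dots> \<le> (\<Sum>z\<in>V. edge_sum V \<nu> \<delta> p u z * measure \<nu> {z})"
    using assms by (intro member_le_sum) (auto simp: edge_sum_nonneg)
  finally show ?thesis using tot L by (simp add: divide_simps)
qed

lemma Lambda_minus_le:
  assumes "finite V" "z \<in> V"
  shows "Lambda_minus V \<nu> \<le> measure \<nu> {z}"
  unfolding Lambda_minus_def using assms by simp

lemma Lambda_minus_le_Lambda_plus:
  assumes "finite V" "V \<noteq> {}"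
  shows "Lambda_minus V \<nu> \<le> Lambda_plus V \<nu>"
proof -
  obtain z where "z \<in> V" using assms by blast
  then have "measure \<nu> {z} \<le> Lambda_plus V \<nu>"
    unfolding Lambda_plus_def using assms by simp
  then show ?thesis using Lambda_minus_le[OF assms(1) \<open>z \<in> V\<close>, of \<nu>] by linarith
qed

locale transported_graph =
  fixes \<Omega> :: "'a::euclidean_space set" and \<mu> :: "'a measure" and \<rho> :: "'a \<Rightarrow> real" and D :: real
    and V :: "'a set" and \<nu> :: "'a measure" and T :: "'a \<Rightarrow> 'a" and \<delta> :: real
  assumes open_domain: "open \<Omega>" and bounded_domain: "bounded \<Omega>"
    and prob_\<mu>: "prob_on \<Omega> \<mu>" and density: "has_continuous_density \<Omega> \<mu> \<rho>"
    and D_pos: "0 < D" and density_ge: "\<And>x. x \<in> \<Omega> \<Longrightarrow> 1 / D \<le> \<rho> x"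
    and graph: "prob_on_finite \<Omega> V \<nu>"
    and T_meas: "T \<in> borel_measurable (restrict_space borel \<Omega>)"
    and T_in: "T \<in> \<Omega> \<rightarrow> V"
    and T_push: "distr \<mu> (restrict_space borel \<Omega>) T = \<nu>"
    and T_close: "\<And>x. x \<in> \<Omega> \<Longrightarrow> norm (T x - x) \<le> \<delta>"
begin

lemma domain_borel [measurable]: "\<Omega> \<in> sets borel"
  using open_domain by simp

lemma sets_\<mu> [measurable_cong, simp]: "sets \<mu> = sets (restrict_space borel \<Omega>)"
  using prob_\<mu> by (simp add: prob_on_def)

lemma sets_\<nu> [measurable_cong, simp]: "sets \<nu> = sets (restrict_space borel \<Omega>)"
  using graph by (simp add: prob_on_finite_def prob_on_def)

lemma space_\<mu> [simp]: "space \<mu> = \<Omega>"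
  using sets_eq_imp_space_eq[OF sets_\<mu>] by (simp add: space_restrict_space)

lemma space_\<nu> [simp]: "space \<nu> = \<Omega>"
  using sets_eq_imp_space_eq[OF sets_\<nu>] by (simp add: space_restrict_space)

lemma prob_space_\<mu>: "prob_space \<mu>" and prob_space_\<nu>: "prob_space \<nu>"
  using prob_\<mu> graph by (auto simp: prob_on_finite_def prob_on_def)

lemma finite_V: "finite V" and V_sub: "V \<subseteq> \<Omega>" and V_nonempty: "V \<noteq> {}"
  using graph by (auto simp: prob_on_finite_def)

lemma T_measurable [measurable]: "T \<in> restrict_space borel \<Omega> \<rightarrow>\<^sub>M restrict_space borel \<Omega>"
  using T_in V_sub by (intro measurable_restrict_space2 T_meas) (auto simp: space_restrict_space)

lemma singleton_sets: "z \<in> V \<Longrightarrow> {z} \<in> sets (restrict_space borel \<Omega>)"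
  using V_sub by (subst sets_restrict_space_iff) auto

lemma fibre_sets: "z \<in> V \<Longrightarrow> T -` {z} \<inter> \<Omega> \<in> sets (restrict_space borel \<Omega>)"
  using measurable_sets[OF T_measurable singleton_sets] by (simp add: space_restrict_space)

lemma fibre_sets_borel: "z \<in> V \<Longrightarrow> T -` {z} \<inter> \<Omega> \<in> sets borel"
  using fibre_sets by (subst (asm) sets_restrict_space_iff) auto

text \<open>
  Change of variables for \<open>T\<close>. As \<open>T\<close> has finitely many values, the integral splits into a sum over its fibres.
\<close>
lemma nn_integral_transport:
  fixes g :: "'a \<Rightarrow> ennreal"
  shows "(\<integral>\<^sup>+x. g (T x) \<partial>\<mu>) = (\<Sum>z\<in>V. g z * ennreal (measure \<nu> {z}))"
proof -
  have "(\<integral>\<^sup>+x. g (T x) \<partial>\<mu>) = (\<integral>\<^sup>+x. (\<Sum>z\<in>V. g z * indicator (T -` {z} \<inter> \<Omega>) x) \<partial>\<mu>)"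
  proof (rule nn_integral_cong)
    fix x assume "x \<in> space \<mu>"
    then have "x \<in> \<Omega>" "T x \<in> V" using T_in by auto
    then have "(\<Sum>z\<in>V. g z * indicator (T -` {z} \<inter> \<Omega>) x) = (\<Sum>z\<in>V. if z = T x then g z else 0)"
      by (intro sum.cong) (auto simp: indicator_def)
    then show "g (T x) = (\<Sum>z\<in>V. g z * indicator (T -` {z} \<inter> \<Omega>) x)"
      using finite_V \<open>T x \<in> V\<close> by simp
  qed
  also have "\<dots> = (\<Sum>z\<in>V. \<integral>\<^sup>+x. g z * indicator (T -` {z} \<inter> \<Omega>) x \<partial>\<mu>)"
    by (intro nn_integral_sum borel_measurable_times_ennreal borel_measurable_indicator borel_measurable_const)
       (simp add: fibre_sets)
  also have "\<dots> = (\<Sum>z\<in>V. g z * ennreal (measure \<nu> {z}))"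
  proof (rule sum.cong)
    fix z assume z: "z \<in> V"
    have "emeasure \<nu> {z} = emeasure \<mu> (T -` {z} \<inter> \<Omega>)"
      unfolding T_push[symmetric] using z by (subst emeasure_distr) (auto simp: singleton_sets)
    moreover have "emeasure \<nu> {z} = ennreal (measure \<nu> {z})"
      using prob_space_\<nu> by (simp add: finite_measure.emeasure_eq_measure prob_space.finite_measure)
    ultimately show "(\<integral>\<^sup>+x. g z * indicator (T -` {z} \<inter> \<Omega>) x \<partial>\<mu>) = g z * ennreal (measure \<nu> {z})"
      using z by (simp add: nn_integral_cmult_indicator fibre_sets)
  qed simp
  finally show ?thesis .
qed

lemma density_measurable: "\<rho> \<in> borel_measurable (restrict_space lborel \<Omega>)"
proof -
  have "\<rho> \<in> borel_measurable (restrict_space borel \<Omega>)"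
    using density by (intro borel_measurable_continuous_on_restrict) (simp add: has_continuous_density_def)
  then show ?thesis by (subst measurable_cong_sets[OF sets_restrict_space_cong[OF sets_lborel] refl])
qed

lemma \<mu>_eq: "\<mu> = density (restrict_space lborel \<Omega>) (\<lambda>x. ennreal (\<rho> x))"
  using density by (simp add: has_continuous_density_def)

lemma nn_integral_lborel_le:
  assumes [measurable]: "g \<in> borel_measurable borel"
  shows "(\<integral>\<^sup>+x. indicator \<Omega> x * g x \<partial>lborel) \<le> ennreal D * (\<integral>\<^sup>+x. g x \<partial>\<mu>)"
proof -
  note density_measurable [measurable]
  have [measurable]: "g \<in> borel_measurable (restrict_space lborel \<Omega>)"
    by (intro measurable_restrict_space1) simp
  have "(\<integral>\<^sup>+x. indicator \<Omega> x * g x \<partial>lborel) = (\<integral>\<^sup>+x. g x \<partial>restrict_space lborel \<Omega>)"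
    by (subst nn_integral_restrict_space) (auto simp: mult.commute)
  also have "\<dots> \<le> (\<integral>\<^sup>+x. ennreal D * (ennreal (\<rho> x) * g x) \<partial>restrict_space lborel \<Omega>)"
  proof (rule nn_integral_mono)
    fix x assume "x \<in> space (restrict_space lborel \<Omega>)"
    then have "1 \<le> D * \<rho> x" using density_ge[of x] D_pos by (simp add: space_restrict_space divide_simps mult.commute)
    then have "ennreal 1 \<le> ennreal (D * \<rho> x)" by (rule ennreal_leI)
    also have "\<dots> = ennreal D * ennreal (\<rho> x)" using D_pos by (simp add: ennreal_mult')
    finally have "1 * g x \<le> (ennreal D * ennreal (\<rho> x)) * g x" by (intro mult_right_mono) auto
    then show "g x \<le> ennreal D * (ennreal (\<rho> x) * g x)" by (simp add: mult.assoc)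
  qed
  also have "\<dots> = ennreal D * (\<integral>\<^sup>+x. g x \<partial>\<mu>)"
    unfolding \<mu>_eq by (simp add: nn_integral_cmult nn_integral_density)
  finally show ?thesis .
qed

lemma AE_\<mu>I:
  assumes "AE x in lborel. x \<in> \<Omega> \<longrightarrow> P x"
  shows "AE x in \<mu>. P x"
proof -
  note density_measurable [measurable]
  have "AE x in restrict_space lborel \<Omega>. P x"
    using assms by (subst AE_restrict_space_iff) auto
  then show ?thesis unfolding \<mu>_eq by (subst AE_density) auto
qed

lemma pull_back_measurable [measurable]: "pull_back \<Omega> T u \<in> borel_measurable borel"
proof -
  have "pull_back \<Omega> T u = (\<lambda>x. \<Sum>z\<in>V. u z * indicator (T -` {z} \<inter> \<Omega>) x)"
  proof
    fix x
    show "pull_back \<Omega> T u x = (\<Sum>z\<in>V. u z * indicator (T -` {z} \<inter> \<Omega>) x)"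
    proof (cases "x \<in> \<Omega>")
      case True
      then have "(\<Sum>z\<in>V. u z * indicator (T -` {z} \<inter> \<Omega>) x) = (\<Sum>z\<in>V. if z = T x then u z else 0)"
        by (intro sum.cong) (auto simp: indicator_def)
      then show ?thesis using finite_V T_in True by (auto simp: pull_back_def)
    qed (simp add: pull_back_def)
  qed
  also have "\<dots> \<in> borel_measurable borel"
    by (intro borel_measurable_sum borel_measurable_times borel_measurable_indicator borel_measurable_const)
       (simp add: fibre_sets_borel)
  finally show ?thesis .
qed

text \<open>
  Since \<open>T\<close> moves points by at most \<open>\<delta>\<close>, points at distance at most \<open>\<tau>\<close> have images at distance at most
  \<open>\<tau> + 2 \<delta>\<close>, so that their jump is counted by an edge of the graph.
\<close>
lemma local_energy_le:
  assumes x: "x \<in> \<Omega>" and r: "\<tau> + 2 * \<delta> \<le> r"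
  shows "(\<integral>\<^sup>+y. jump \<Omega> \<tau> p (pull_back \<Omega> T u) x y \<partial>lborel) \<le> ennreal (D * edge_sum V \<nu> r p u (T x))"
proof -
  let ?F = "\<lambda>w. ennreal (if dist (T x) w \<le> r then \<bar>u (T x) - u w\<bar> powr p else 0)"
  have "(\<integral>\<^sup>+y. jump \<Omega> \<tau> p (pull_back \<Omega> T u) x y \<partial>lborel)
      = (\<integral>\<^sup>+y. indicator \<Omega> y * jump \<Omega> \<tau> p (pull_back \<Omega> T u) x y \<partial>lborel)"
    by (intro nn_integral_cong) (auto simp: jump_def indicator_def)
  also have "\<dots> \<le> ennreal D * (\<integral>\<^sup>+y. jump \<Omega> \<tau> p (pull_back \<Omega> T u) x y \<partial>\<mu>)"
    by (rule nn_integral_lborel_le) measurable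
  also have "\<dots> \<le> ennreal D * (\<integral>\<^sup>+y. ?F (T y) \<partial>\<mu>)"
  proof (intro mult_left_mono nn_integral_mono)
    fix y assume "y \<in> space \<mu>"
    then have y: "y \<in> \<Omega>" by simp
    have "dist (T x) (T y) \<le> dist (T x) x + (dist x y + dist y (T y))"
      by (meson add_left_mono dist_triangle order_trans)
    then have "dist x y \<le> \<tau> \<Longrightarrow> dist (T x) (T y) \<le> r"
      using T_close[OF x] T_close[OF y] r by (simp add: dist_norm norm_minus_commute)
    then show "jump \<Omega> \<tau> p (pull_back \<Omega> T u) x y \<le> ?F (T y)"
      using x y by (auto simp: jump_def pull_back_def)
  qed simp
  also have "\<dots> = ennreal D * (\<Sum>w\<in>V. ?F w * ennreal (measure \<nu> {w}))"
    by (subst nn_integral_transport) simp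
  also have "\<dots> = ennreal (D * edge_sum V \<nu> r p u (T x))"
    using D_pos unfolding edge_sum_def
    by (subst ennreal_mult) (auto simp: sum_nonneg simp flip: ennreal_mult sum_ennreal intro!: sum_nonneg)
  finally show ?thesis .
qed

lemma jump_energy_le:
  assumes r: "\<tau> + 2 * \<delta> \<le> r"
  shows "jump_energy \<Omega> \<tau> p (pull_back \<Omega> T u) \<le> ennreal (D\<^sup>2 * (\<Sum>z\<in>V. edge_sum V \<nu> r p u z * measure \<nu> {z}))"
proof -
  let ?G = "\<lambda>x. \<integral>\<^sup>+y. jump \<Omega> \<tau> p (pull_back \<Omega> T u) x y \<partial>lborel"
  have "?G x = indicator \<Omega> x * ?G x" for x
  proof (cases "x \<in> \<Omega>")
    case False
    then show ?thesis by (simp add: jump_def)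
  qed simp
  then have "jump_energy \<Omega> \<tau> p (pull_back \<Omega> T u) = (\<integral>\<^sup>+x. indicator \<Omega> x * ?G x \<partial>lborel)"
    unfolding jump_energy_def by (rule nn_integral_cong)
  also have "\<dots> \<le> ennreal D * (\<integral>\<^sup>+x. ?G x \<partial>\<mu>)"
    by (rule nn_integral_lborel_le) measurable
  also have "\<dots> \<le> ennreal D * (\<integral>\<^sup>+x. ennreal (D * edge_sum V \<nu> r p u (T x)) \<partial>\<mu>)"
    using r by (intro mult_left_mono nn_integral_mono local_energy_le) auto
  also have "\<dots> = ennreal D * (\<Sum>z\<in>V. ennreal (D * edge_sum V \<nu> r p u z) * ennreal (measure \<nu> {z}))"
    by (subst nn_integral_transport[of "\<lambda>z. ennreal (D * edge_sum V \<nu> r p u z)"]) simp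
  also have "\<dots> = ennreal D * ennreal (\<Sum>z\<in>V. (D * edge_sum V \<nu> r p u z) * measure \<nu> {z})"
    using D_pos edge_sum_nonneg[of V \<nu> r p u] by (simp flip: ennreal_mult'' sum_ennreal)
  also have "\<dots> = ennreal (D\<^sup>2 * (\<Sum>z\<in>V. edge_sum V \<nu> r p u z * measure \<nu> {z}))"
    using D_pos by (simp add: power2_eq_square sum_distrib_left mult.assoc flip: ennreal_mult')
  finally show ?thesis .
qed

lemma Lp_le:
  "(\<integral>\<^sup>+y. indicator \<Omega> y * ennreal (\<bar>pull_back \<Omega> T u y\<bar> powr p) \<partial>lborel)
    \<le> ennreal (D * (\<Sum>z\<in>V. \<bar>u z\<bar> powr p * measure \<nu> {z}))"
proof -
  have "(\<integral>\<^sup>+y. indicator \<Omega> y * ennreal (\<bar>pull_back \<Omega> T u y\<bar> powr p) \<partial>lborel)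
      \<le> ennreal D * (\<integral>\<^sup>+y. ennreal (\<bar>pull_back \<Omega> T u y\<bar> powr p) \<partial>\<mu>)"
    by (rule nn_integral_lborel_le) measurable
  also have "(\<integral>\<^sup>+y. ennreal (\<bar>pull_back \<Omega> T u y\<bar> powr p) \<partial>\<mu>) = (\<integral>\<^sup>+y. ennreal (\<bar>u (T y)\<bar> powr p) \<partial>\<mu>)"
    by (intro nn_integral_cong) (auto simp: pull_back_def)
  also have "\<dots> = (\<Sum>z\<in>V. ennreal (\<bar>u z\<bar> powr p) * ennreal (measure \<nu> {z}))"
    by (rule nn_integral_transport[of "\<lambda>z. ennreal (\<bar>u z\<bar> powr p)"])
  also have "ennreal D * \<dots> = ennreal (D * (\<Sum>z\<in>V. \<bar>u z\<bar> powr p * measure \<nu> {z}))"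
    using D_pos by (simp add: sum_ennreal sum_nonneg flip: ennreal_mult' ennreal_mult'')
  finally show ?thesis .
qed

end


section \<open>Transport distances\<close>

lemma TL_dist_nonneg:
  assumes "\<gamma> \<in> couplings \<nu> \<mu>"
  shows "0 \<le> TL_dist r (f, \<nu>) (g, \<mu>)"
  unfolding TL_dist_def using assms by (auto intro!: cINF_greatest)

context transported_graph
begin

lemma TL_space_graph:
  assumes "0 \<le> r"
  shows "(zero_extension V u, \<nu>) \<in> TL_space r \<Omega>"
proof -
  interpret prob_space \<nu> by (rule prob_space_\<nu>)
  obtain b where b: "\<And>x. x \<in> \<Omega> \<Longrightarrow> norm x \<le> b"
    using bounded_domain by (auto simp: bounded_iff)
  have ze: "zero_extension V u \<in> borel_measurable \<nu>"
  proof -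
    have "zero_extension V u = (\<lambda>x. \<Sum>z\<in>V. u z * indicator {z} x)"
      using finite_V by (auto simp: zero_extension_def fun_eq_iff indicator_def if_distrib cong: if_cong)
    also have "\<dots> \<in> borel_measurable \<nu>"
      by (intro borel_measurable_sum borel_measurable_times borel_measurable_indicator borel_measurable_const)
         (simp add: singleton_sets)
    finally show ?thesis .
  qed
  note ze [measurable]
  have idm [measurable]: "(\<lambda>x. x) \<in> \<nu> \<rightarrow>\<^sub>M borel"
    by (subst measurable_cong_sets[OF sets_\<nu> refl]) (simp add: measurable_restrict_space1)
  have "integrable \<nu> (\<lambda>x. norm x powr r)"
    using b assms by (intro integrable_const_bound[of _ "b powr r"] AE_I2) (auto intro!: powr_mono2)
  moreover have "integrable \<nu> (\<lambda>x. \<bar>zero_extension V u x\<bar> powr r)"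
  proof (rule integrable_const_bound[of _ "(\<Sum>z\<in>V. \<bar>u z\<bar>) powr r"])
    have "\<bar>zero_extension V u x\<bar> \<le> (\<Sum>z\<in>V. \<bar>u z\<bar>)" for x
      using finite_V member_le_sum[of x V "\<lambda>z. \<bar>u z\<bar>"] by (auto simp: zero_extension_def sum_nonneg)
    then show "AE x in \<nu>. norm (\<bar>zero_extension V u x\<bar> powr r) \<le> (\<Sum>z\<in>V. \<bar>u z\<bar>) powr r"
      using assms by (intro AE_I2) (auto intro!: powr_mono2)
  qed measurable
  ultimately show ?thesis
    using graph by (simp add: TL_space_def prob_on_finite_def ze)
qed

lemma transport_coupling: "distr \<mu> (\<nu> \<Otimes>\<^sub>M \<mu>) (\<lambda>x. (T x, x)) \<in> couplings \<nu> \<mu>"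
proof -
  have [measurable]: "T \<in> \<mu> \<rightarrow>\<^sub>M \<nu>"
    using T_measurable by (subst measurable_cong_sets[OF sets_\<mu> sets_\<nu>])
  have "distr \<mu> \<nu> T = distr \<mu> (restrict_space borel \<Omega>) T"
    by (intro distr_cong) auto
  then have "distr \<mu> \<nu> T = \<nu>" using T_push by simp
  then show ?thesis
    unfolding couplings_def by (simp add: distr_distr comp_def distr_id)
qed

text \<open>The transport plan \<open>(T, id)\<close> competes in the infimum that defines the distance.\<close>
lemma TL_dist_transport_le:
  assumes [measurable]: "v \<in> borel_measurable \<mu>"
  shows "TL_dist r (zero_extension V u, \<nu>) (v, \<mu>)
    \<le> (\<integral>x. norm (T x - x) powr r + \<bar>pull_back \<Omega> T u x - v x\<bar> powr r \<partial>\<mu>) powr (1 / r)"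
proof -
  have [measurable]: "T \<in> \<mu> \<rightarrow>\<^sub>M \<nu>"
    using T_measurable by (subst measurable_cong_sets[OF sets_\<mu> sets_\<nu>])
  have [measurable]: "(\<lambda>x. x) \<in> \<nu> \<rightarrow>\<^sub>M borel" "(\<lambda>x. x) \<in> \<mu> \<rightarrow>\<^sub>M borel"
    by (simp_all add: measurable_restrict_space1 measurable_cong_sets[OF sets_\<nu> refl] measurable_cong_sets[OF sets_\<mu> refl])
  have [measurable]: "zero_extension V u \<in> borel_measurable \<nu>"
    using TL_space_graph[of 1 u] by (simp add: TL_space_def)
  let ?\<gamma> = "distr \<mu> (\<nu> \<Otimes>\<^sub>M \<mu>) (\<lambda>x. (T x, x))"
  let ?F = "\<lambda>(x, y). norm (x - y) powr r + \<bar>zero_extension V u x - v y\<bar> powr r"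
  have [measurable]: "fst \<in> (\<nu> \<Otimes>\<^sub>M \<mu>) \<rightarrow>\<^sub>M borel" "snd \<in> (\<nu> \<Otimes>\<^sub>M \<mu>) \<rightarrow>\<^sub>M borel"
    using measurable_compose[OF measurable_fst[of \<nu> \<mu>], of "\<lambda>x. x" borel]
      measurable_compose[OF measurable_snd[of \<nu> \<mu>], of "\<lambda>x. x" borel] by simp_all
  have F: "?F \<in> borel_measurable (\<nu> \<Otimes>\<^sub>M \<mu>)"
    unfolding case_prod_beta by measurable
  have "TL_dist r (zero_extension V u, \<nu>) (v, \<mu>) \<le> (\<integral>w. ?F w \<partial>?\<gamma>) powr (1 / r)"
    unfolding TL_dist_def prod.case
    by (intro cINF_lower transport_coupling bdd_belowI2[of _ 0]) simp
  also have "(\<integral>w. ?F w \<partial>?\<gamma>) = (\<integral>x. ?F (T x, x) \<partial>\<mu>)"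
    by (intro integral_distr F) measurable
  also have "\<dots> = (\<integral>x. norm (T x - x) powr r + \<bar>pull_back \<Omega> T u x - v x\<bar> powr r \<partial>\<mu>)"
    using T_in by (intro Bochner_Integration.integral_cong) (auto simp: pull_back_def zero_extension_def)
  finally show ?thesis .
qed

end

text \<open>
  For a uniformly bounded sequence, almost everywhere convergence on the fixed probability space
  \<open>\<mu>\<close> gives convergence in every \<open>L\<^sup>r\<close> by dominated convergence, and the transport distance
  vanishes because \<open>\<delta>\<close> does.
\<close>
lemma TL_limit_of_bounded_AE_convergent:
  fixes \<Omega> :: "'a::euclidean_space set"
  assumes graph: "\<And>n. transported_graph \<Omega> \<mu> \<rho> D (V n) (\<nu> n) (T n) (\<delta> n)" and \<delta>: "\<delta> \<longlonglongrightarrow> 0"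
    and M: "\<And>n x. x \<in> \<Omega> \<Longrightarrow> \<bar>pull_back \<Omega> (T n) (u n) x\<bar> \<le> M"
    and conv: "AE x in lborel. x \<in> \<Omega> \<longrightarrow> convergent (\<lambda>n. pull_back \<Omega> (T n) (u n) x)"
    and r: "1 \<le> r"
  shows "\<exists>b\<in>TL_space r \<Omega>. (\<lambda>n. TL_dist r (zero_extension (V n) (u n), \<nu> n) b) \<longlonglongrightarrow> 0"
proof -
  interpret G: transported_graph \<Omega> \<mu> \<rho> D "V n" "\<nu> n" "T n" "\<delta> n" for n by (rule graph)
  define f where "f n = pull_back \<Omega> (T n) (u n)" for n
  define v where "v x = lim (\<lambda>n. f n x)" for x
  interpret prob_space \<mu> by (rule G.prob_space_\<mu>)
  note G.sets_\<mu> [measurable_cong]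
  have [measurable]: "(\<lambda>x. x) \<in> \<mu> \<rightarrow>\<^sub>M borel"
    by (simp add: measurable_restrict_space1 measurable_cong_sets[OF G.sets_\<mu> refl])
  have f_borel: "f n \<in> borel_measurable borel" for n unfolding f_def by (rule G.pull_back_measurable)
  have [measurable]: "f n \<in> borel_measurable \<mu>" for n
    using measurable_compose[OF _ f_borel[of n], of "\<lambda>x. x" \<mu>] by simp
  have v [measurable]: "v \<in> borel_measurable \<mu>"
    unfolding v_def by measurable
  have T [measurable]: "T n \<in> borel_measurable \<mu>" for n
    using G.T_meas[of n] by (simp add: measurable_cong_sets[OF G.sets_\<mu> refl])
  have lim: "AE x in \<mu>. (\<lambda>n. f n x) \<longlonglongrightarrow> v x"
    using G.AE_\<mu>I[OF conv] by eventually_elim (simp add: v_def f_def convergent_LIMSEQ_iff)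
  have fM: "\<bar>f n x\<bar> \<le> M" if "x \<in> \<Omega>" for n x unfolding f_def using that by (rule M)
  have "AE x in \<mu>. x \<in> \<Omega>" using AE_space[of \<mu>] by simp
  then have vM: "AE x in \<mu>. \<bar>v x\<bar> \<le> M"
    using lim
  proof eventually_elim
    case (elim x)
    show ?case
      by (rule tendsto_upperbound[OF tendsto_rabs[OF elim(2)]]) (use fM[OF elim(1)] in auto)
  qed
  have mem: "(v, \<mu>) \<in> TL_space r \<Omega>"
  proof -
    obtain b where b: "\<And>x. x \<in> \<Omega> \<Longrightarrow> norm x \<le> b"
      using G.bounded_domain by (auto simp: bounded_iff)
    have "integrable \<mu> (\<lambda>x. norm x powr r)"
      using b r by (intro integrable_const_bound[of _ "b powr r"] AE_I2) (auto intro!: powr_mono2)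
    moreover have "integrable \<mu> (\<lambda>x. \<bar>v x\<bar> powr r)"
      using vM r by (intro integrable_const_bound[of _ "M powr r"]) (auto elim!: eventually_mono intro!: powr_mono2)
    ultimately show ?thesis using G.prob_\<mu> by (simp add: TL_space_def v)
  qed
  obtain d where d: "\<And>n. \<bar>\<delta> n\<bar> \<le> d"
    using convergent_imp_Bseq[OF convergentI[OF \<delta>]] by (auto simp: Bseq_def)
  define I where "I n = (\<integral>x. norm (T n x - x) powr r + \<bar>f n x - v x\<bar> powr r \<partial>\<mu>)" for n
  have "I \<longlonglongrightarrow> (\<integral>x. 0 \<partial>\<mu>)"
    unfolding I_def
  proof (rule integral_dominated_convergence)
    show "integrable \<mu> (\<lambda>x. d powr r + (2 * M) powr r)" by simp
    show "AE x in \<mu>. (\<lambda>n. norm (T n x - x) powr r + \<bar>f n x - v x\<bar> powr r) \<longlonglongrightarrow> 0"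
      using lim \<open>AE x in \<mu>. x \<in> \<Omega>\<close>
    proof eventually_elim
      case (elim x)
      have "(\<lambda>n. norm (T n x - x)) \<longlonglongrightarrow> 0"
        using \<delta> by (rule Lim_null_comparison[rotated]) (use G.T_close[OF elim(2)] in auto)
      moreover have "(\<lambda>n. \<bar>f n x - v x\<bar>) \<longlonglongrightarrow> 0"
        using elim(1) by (simp add: LIM_zero tendsto_rabs_zero)
      ultimately have "(\<lambda>n. norm (T n x - x) powr r + \<bar>f n x - v x\<bar> powr r) \<longlonglongrightarrow> 0 + 0"
        using r by (intro tendsto_add tendsto_zero_powrI[OF _ tendsto_const]) auto
      then show ?case by simp
    qed
    show "AE x in \<mu>. norm (norm (T n x - x) powr r + \<bar>f n x - v x\<bar> powr r) \<le> d powr r + (2 * M) powr r" for n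
      using vM \<open>AE x in \<mu>. x \<in> \<Omega>\<close>
    proof eventually_elim
      case (elim x)
      have "norm (T n x - x) \<le> d" using G.T_close[OF elim(2), of n] d[of n] by simp
      moreover have "\<bar>f n x - v x\<bar> \<le> 2 * M" using elim(1) fM[OF elim(2), of n] by linarith
      ultimately have "norm (T n x - x) powr r + \<bar>f n x - v x\<bar> powr r \<le> d powr r + (2 * M) powr r"
        using r by (intro add_mono powr_mono2) auto
      then show ?case by simp
    qed
  qed measurable
  then have I: "I \<longlonglongrightarrow> 0" by simp
  have "0 \<le> I n" for n unfolding I_def by simp
  then have "(\<lambda>n. I n powr (1 / r)) \<longlonglongrightarrow> 0"
    using r by (intro tendsto_zero_powrI[OF I tendsto_const]) auto
  then have "(\<lambda>n. TL_dist r (zero_extension (V n) (u n), \<nu> n) (v, \<mu>)) \<longlonglongrightarrow> 0"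
  proof (rule tendsto_sandwich[OF _ _ tendsto_const, rotated 2])
    show "\<forall>\<^sub>F n in sequentially. 0 \<le> TL_dist r (zero_extension (V n) (u n), \<nu> n) (v, \<mu>)"
      by (intro always_eventually allI TL_dist_nonneg[OF G.transport_coupling])
    show "\<forall>\<^sub>F n in sequentially. TL_dist r (zero_extension (V n) (u n), \<nu> n) (v, \<mu>) \<le> I n powr (1 / r)"
      unfolding I_def f_def by (intro always_eventually allI G.TL_dist_transport_le v)
  qed
  with mem show ?thesis by blast
qed


section \<open>Compactness\<close>

text \<open>
  The scale \<open>\<tau> n = s0 / 2 * \<epsilon> n\<close> leaves room for the displacement of both end points: with
  \<open>K \<le> s0 / 4\<close>, jumps of length \<open>\<tau> n\<close> become edges of length at most \<open>s0 * \<epsilon> n\<close>. The bound on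
  \<open>\<epsilon> powr p * Lambda_plus / Lambda_minus\<^sup>2\<close> enters through \<open>\<epsilon> powr p / Lambda_minus \<le> A\<close>, which bounds the local
  energy at every vertex and so makes the uniform bound possible.
\<close>
lemma graph_functions_relatively_compact:
  fixes \<Omega> :: "'a::euclidean_space set" and \<epsilon> :: "nat \<Rightarrow> real" and u :: "nat \<Rightarrow> 'a \<Rightarrow> real"
  assumes \<Omega>: "open \<Omega>" "bounded \<Omega>" "lipschitz_boundary \<Omega>"
    and kernel: "\<And>s. 0 \<le> s \<Longrightarrow> 0 \<le> \<eta> s" "\<And>s. 0 \<le> s \<Longrightarrow> s \<le> s0 \<Longrightarrow> c \<le> \<eta> s" "0 < s0" "0 < c"
    and p: "real DIM('a) < p" and r: "1 \<le> r"
    and \<epsilon>: "\<And>n. 0 < \<epsilon> n" "\<epsilon> \<longlonglongrightarrow> 0"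
    and K: "K \<le> s0 / 4"
    and graph: "\<And>n. transported_graph \<Omega> \<mu> \<rho> D (V n) (\<nu> n) (T n) (K * \<epsilon> n)"
    and \<Lambda>_pos: "\<And>n. 0 < Lambda_minus (V n) (\<nu> n)"
    and \<Lambda>_bound: "\<And>n. \<epsilon> n powr p * Lambda_plus (V n) (\<nu> n) / (Lambda_minus (V n) (\<nu> n))\<^sup>2 \<le> A"
    and norm_bound: "\<And>n. discrete_Lp_norm (V n) (\<nu> n) p (u n) \<le> N"
    and energy_bound: "\<And>n. graph_energy \<eta> p (\<epsilon> n) (V n) (\<nu> n) (u n) \<le> E"
    and nonneg: "0 \<le> E" "0 \<le> A" "0 \<le> N"
  shows "TL_relatively_compact r \<Omega> (\<lambda>n. (zero_extension (V n) (u n), \<nu> n))"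
proof -
  interpret G: transported_graph \<Omega> \<mu> \<rho> D "V n" "\<nu> n" "T n" "K * \<epsilon> n" for n by (rule graph)
  have p1: "1 \<le> p" using p DIM_positive[where 'a='a] by linarith
  define f where "f n = pull_back \<Omega> (T n) (u n)" for n
  define \<tau> where "\<tau> n = s0 / 2 * \<epsilon> n" for n
  have \<tau>_pos: "0 < \<tau> n" for n using \<epsilon>(1)[of n] kernel(3) by (simp add: \<tau>_def)
  have \<tau>: "\<tau> \<longlonglongrightarrow> 0" unfolding \<tau>_def using tendsto_mult[OF tendsto_const \<epsilon>(2)] by simp
  have \<epsilon>\<tau>: "\<epsilon> n = 2 / s0 * \<tau> n" for n using kernel(3) by (simp add: \<tau>_def)
  have reach: "\<tau> n + 2 * (K * \<epsilon> n) \<le> s0 * \<epsilon> n" for n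
  proof -
    have "K * \<epsilon> n \<le> s0 / 4 * \<epsilon> n" using K \<epsilon>(1)[of n] by (intro mult_right_mono) auto
    then show ?thesis unfolding \<tau>_def by linarith
  qed
  have edges: "(\<Sum>z\<in>V n. edge_sum (V n) (\<nu> n) (s0 * \<epsilon> n) p (u n) z * measure (\<nu> n) {z}) \<le> \<epsilon> n powr (p + real DIM('a)) / c * E" for n
  proof -
    have "(\<Sum>z\<in>V n. edge_sum (V n) (\<nu> n) (s0 * \<epsilon> n) p (u n) z * measure (\<nu> n) {z})
        \<le> \<epsilon> n powr (p + real DIM('a)) / c * graph_energy \<eta> p (\<epsilon> n) (V n) (\<nu> n) (u n)"
      by (rule sum_edge_sum_le_graph_energy[OF G.finite_V \<epsilon>(1) kernel(4) kernel(1,2)])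
    also have "\<dots> \<le> \<epsilon> n powr (p + real DIM('a)) / c * E"
      using kernel(4) by (intro mult_left_mono energy_bound) auto
    finally show ?thesis .
  qed
  define B where "B = D\<^sup>2 * E / c * (2 / s0) powr (p + real DIM('a))"
  define H where "H = D * E * A / c * (2 / s0) ^ DIM('a)"
  define N' where "N' = D * N powr p"
  have const_nonneg: "0 \<le> B" "0 \<le> H" "0 \<le> N'"
    using nonneg kernel G.D_pos by (auto simp: B_def H_def N'_def)
  have scale: "energy_at_scale \<Omega> (f n) p (\<tau> n) B" for n
  proof
    have "jump_energy \<Omega> (\<tau> n) p (f n) \<le> ennreal (D\<^sup>2 * (\<Sum>z\<in>V n. edge_sum (V n) (\<nu> n) (s0 * \<epsilon> n) p (u n) z * measure (\<nu> n) {z}))"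
      unfolding f_def by (rule G.jump_energy_le[OF reach])
    also have "\<dots> \<le> ennreal (D\<^sup>2 * (\<epsilon> n powr (p + real DIM('a)) / c * E))"
      by (intro ennreal_leI mult_left_mono edges) auto
    also have "D\<^sup>2 * (\<epsilon> n powr (p + real DIM('a)) / c * E) = B * \<tau> n powr (p + real DIM('a))"
    proof -
      have "\<epsilon> n powr (p + real DIM('a)) = (2 / s0) powr (p + real DIM('a)) * \<tau> n powr (p + real DIM('a))"
        unfolding \<epsilon>\<tau>[of n] using \<tau>_pos[of n] kernel(3) by (simp only: powr_mult)
      then show ?thesis by (simp add: B_def)
    qed
    finally show "jump_energy \<Omega> (\<tau> n) p (f n) \<le> ennreal (B * \<tau> n powr (p + real DIM('a)))" .
  qed (use p \<tau>_pos const_nonneg in \<open>auto simp: f_def\<close>)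
  interpret S: energy_at_scale \<Omega> "f n" p "\<tau> n" B for n by (rule scale)
  have loc: "(\<integral>\<^sup>+y. jump \<Omega> (\<tau> n) p (f n) x y \<partial>lborel) \<le> ennreal (H * \<tau> n ^ DIM('a))" if x: "x \<in> \<Omega>" for n x
  proof -
    let ?L = "Lambda_minus (V n) (\<nu> n)"
    have Tx: "T n x \<in> V n" using G.T_in x by auto
    have "\<epsilon> n powr p * ?L / ?L\<^sup>2 \<le> \<epsilon> n powr p * Lambda_plus (V n) (\<nu> n) / ?L\<^sup>2"
      by (intro divide_right_mono mult_left_mono Lambda_minus_le_Lambda_plus G.finite_V G.V_nonempty) auto
    then have "\<epsilon> n powr p * ?L / ?L\<^sup>2 \<le> A" using \<Lambda>_bound[of n] by linarith
    then have eL: "\<epsilon> n powr p / ?L \<le> A" using \<Lambda>_pos[of n] by (simp add: power2_eq_square)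
    have "(\<integral>\<^sup>+y. jump \<Omega> (\<tau> n) p (f n) x y \<partial>lborel) \<le> ennreal (D * edge_sum (V n) (\<nu> n) (s0 * \<epsilon> n) p (u n) (T n x))"
      unfolding f_def by (rule G.local_energy_le[OF x reach])
    also have "\<dots> \<le> ennreal (D * (\<epsilon> n powr (p + real DIM('a)) / c * E / ?L))"
      using G.D_pos by (intro ennreal_leI mult_left_mono edge_sum_le[OF G.finite_V Tx edges \<Lambda>_pos Lambda_minus_le[OF G.finite_V Tx]]) auto
    also have "\<dots> \<le> ennreal (D * E / c * \<epsilon> n ^ DIM('a) * A)"
    proof (rule ennreal_leI)
      have "D * (\<epsilon> n powr (p + real DIM('a)) / c * E / ?L) = D * E / c * \<epsilon> n ^ DIM('a) * (\<epsilon> n powr p / ?L)"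
        using \<epsilon>(1)[of n] by (simp add: powr_add powr_realpow)
      also have "\<dots> \<le> D * E / c * \<epsilon> n ^ DIM('a) * A"
        using eL nonneg G.D_pos kernel(4) \<epsilon>(1)[of n] by (intro mult_left_mono) auto
      finally show "D * (\<epsilon> n powr (p + real DIM('a)) / c * E / ?L) \<le> D * E / c * \<epsilon> n ^ DIM('a) * A" .
    qed
    also have "D * E / c * \<epsilon> n ^ DIM('a) * A = H * \<tau> n ^ DIM('a)"
      unfolding \<epsilon>\<tau>[of n] H_def by (simp add: power_mult_distrib power_divide)
    finally show ?thesis .
  qed
  have Lp: "(\<integral>\<^sup>+y. indicator \<Omega> y * ennreal (\<bar>f n y\<bar> powr p) \<partial>lborel) \<le> ennreal N'" for n
  proof -
    let ?s = "\<Sum>z\<in>V n. \<bar>u n z\<bar> powr p * measure (\<nu> n) {z}"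
    have s0: "0 \<le> ?s" by (intro sum_nonneg) auto
    have "?s = (discrete_Lp_norm (V n) (\<nu> n) p (u n)) powr p"
      using s0 p1 by (simp add: discrete_Lp_norm_def powr_powr)
    also have "\<dots> \<le> N powr p" using p1 norm_bound[of n] by (intro powr_mono2) (auto simp: discrete_Lp_norm_def)
    finally have "D * ?s \<le> N'" unfolding N'_def using G.D_pos by (intro mult_left_mono) auto
    then show ?thesis unfolding f_def using G.Lp_le[of n "u n" p] by (meson ennreal_leI order_trans)
  qed
  obtain R \<beta> where cone: "0 < R" "0 < \<beta>" "\<And>z. z \<in> \<Omega> \<Longrightarrow> \<exists>Q. interior_cone \<Omega> R \<beta> z Q"
    by (rule lipschitz_boundary_uniform_cone[OF \<Omega>]) blast
  define M where "M = sup_const DIM('a) p B H N' R \<beta>"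
  have sup: "\<bar>f n x\<bar> \<le> M" if "\<tau> n \<le> R" and x: "x \<in> \<Omega>" for n x
  proof -
    obtain Q where "interior_cone \<Omega> R \<beta> x Q" using cone(3)[OF x] by blast
    then show ?thesis unfolding M_def using that cone(2) const_nonneg loc Lp by (intro S.sup_bound) auto
  qed
  \<comment> \<open>The uniform bound needs the scale to be below the cone size, hence only the tail of the sequence is used.\<close>
  have "\<forall>\<^sub>F n in sequentially. \<tau> n < R" using \<tau> cone(1) by (rule order_tendstoD)
  then obtain n0 where n0: "\<And>n. n \<ge> n0 \<Longrightarrow> \<tau> n \<le> R" unfolding eventually_sequentially by (meson less_imp_le)
  show ?thesis
    unfolding TL_relatively_compact_def
  proof (intro conjI allI impI)
    show "(zero_extension (V n) (u n), \<nu> n) \<in> TL_space r \<Omega>" for n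
      using r by (intro G.TL_space_graph) simp
  next
    fix k :: "nat \<Rightarrow> nat" assume k: "strict_mono k"
    define k' where "k' n = k (n + n0)" for n
    have k': "strict_mono k'" unfolding k'_def using k by (auto simp: strict_mono_def)
    have "n0 \<le> k' n" for n unfolding k'_def using seq_suble[OF k, of "n + n0"] by linarith
    then have bd: "\<bar>f (k' n) x\<bar> \<le> M" if "x \<in> \<Omega>" for n x using sup[OF n0 that] by blast
    have "(\<lambda>n. \<tau> (k' n)) \<longlonglongrightarrow> 0" using LIMSEQ_subseq_LIMSEQ[OF \<tau> k'] by (simp add: o_def)
    then obtain l where l: "strict_mono l" "AE x in lborel. x \<in> \<Omega> \<longrightarrow> convergent (\<lambda>n. f (k' (l n)) x)"
      using subsequence_converges_AE[OF \<Omega>(1,2), where f = "\<lambda>n. f (k' n)" and p = p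
          and \<tau> = "\<lambda>n. \<tau> (k' n)" and B = B and M = M] scale bd by blast
    have "(\<lambda>n. K * \<epsilon> (k' (l n))) \<longlonglongrightarrow> 0"
      using tendsto_mult[OF tendsto_const LIMSEQ_subseq_LIMSEQ[OF \<epsilon>(2) strict_mono_o[OF k' l(1)]], of K]
      by (simp add: o_def)
    then have "\<exists>b\<in>TL_space r \<Omega>. (\<lambda>n. TL_dist r (zero_extension (V (k' (l n))) (u (k' (l n))), \<nu> (k' (l n))) b) \<longlonglongrightarrow> 0"
      using graph bd l(2) r unfolding f_def
      by (intro TL_limit_of_bounded_AE_convergent[where \<mu> = \<mu> and \<rho> = \<rho> and D = D and M = M
            and T = "\<lambda>n. T (k' (l n))" and \<delta> = "\<lambda>n. K * \<epsilon> (k' (l n))"]) auto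
    moreover have "strict_mono (\<lambda>n. l n + n0)" using l(1) by (auto simp: strict_mono_def)
    ultimately show "\<exists>l. strict_mono l \<and> (\<exists>b\<in>TL_space r \<Omega>.
        (\<lambda>n. TL_dist r (zero_extension (V (k (l n))) (u (k (l n))), \<nu> (k (l n))) b) \<longlonglongrightarrow> 0)"
      unfolding k'_def by blast
  qed
qed

lemma kernel_lower_bound_near_0:
  fixes \<eta> :: "real \<Rightarrow> real"
  assumes "continuous (at 0 within {0..}) \<eta>" "0 < \<eta> 0"
  shows "\<exists>s0>0. \<forall>s. 0 \<le> s \<longrightarrow> s \<le> s0 \<longrightarrow> \<eta> 0 / 2 \<le> \<eta> s"
proof -
  have "\<forall>e>0. \<exists>d>0. \<forall>s\<in>{0..}. dist s 0 < d \<longrightarrow> dist (\<eta> s) (\<eta> 0) < e"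
    using assms(1) by (simp add: continuous_within_eps_delta)
  then obtain d where d: "0 < d" "\<And>s. s \<ge> 0 \<Longrightarrow> dist s 0 < d \<Longrightarrow> dist (\<eta> s) (\<eta> 0) < \<eta> 0 / 2"
    using assms(2) by (metis atLeast_iff half_gt_zero)
  have "\<eta> 0 / 2 \<le> \<eta> s" if "0 \<le> s" "s \<le> d / 2" for s
  proof -
    have "dist (\<eta> s) (\<eta> 0) < \<eta> 0 / 2" using d that by (intro d(2)) (auto simp: dist_real_def)
    then show ?thesis unfolding dist_real_def by linarith
  qed
  then show ?thesis using d(1) by (intro exI[of _ "d / 2"]) auto
qed

theorem corollary5p17:
  fixes \<Omega> :: "'a::euclidean_space set" and \<eta> :: "real \<Rightarrow> real"
  assumes "open \<Omega>" and "bounded \<Omega>" and "lipschitz_boundary \<Omega>"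
    and "\<forall>s\<ge>0. 0 \<le> \<eta> s"
  shows "\<exists>S>0. \<forall>p>real DIM('a).
    \<forall>(\<mu> :: 'a measure) (\<rho> :: 'a \<Rightarrow> real) (V :: nat \<Rightarrow> 'a set) (\<mu>\<^sub>n :: nat \<Rightarrow> 'a measure)
      (\<epsilon> :: nat \<Rightarrow> real) (u :: nat \<Rightarrow> 'a \<Rightarrow> real).
      prob_on \<Omega> \<mu> \<longrightarrow> has_continuous_density \<Omega> \<mu> \<rho> \<longrightarrow>
      (\<forall>n. prob_on_finite \<Omega> (V n) (\<mu>\<^sub>n n)) \<longrightarrow>
      (\<forall>n. 0 < \<epsilon> n) \<longrightarrow> \<epsilon> \<longlonglongrightarrow> 0 \<longrightarrow>
      (\<exists>K>0. K \<le> S \<and>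
         (\<exists>T :: nat \<Rightarrow> 'a \<Rightarrow> 'a. \<forall>n.
            T n \<in> borel_measurable (restrict_space borel \<Omega>) \<and> T n \<in> \<Omega> \<rightarrow> V n \<and>
            distr \<mu> (restrict_space borel \<Omega>) (T n) = \<mu>\<^sub>n n \<and>
            (SUP x\<in>\<Omega>. norm (T n x - x)) \<le> K * \<epsilon> n)) \<longrightarrow>
      continuous (at 0 within {0..}) \<eta> \<longrightarrow> antimono_on {0..} \<eta> \<longrightarrow> 0 < \<eta> 0 \<longrightarrow>
      (\<exists>D>0. \<forall>x\<in>\<Omega>. 1 / D \<le> \<rho> x \<and> \<rho> x \<le> D) \<longrightarrow>
      (\<exists>t>p. kernel_moment DIM('a) \<eta> t < \<infinity>) \<longrightarrow>
      (\<forall>n. 0 < Lambda_minus (V n) (\<mu>\<^sub>n n)) \<longrightarrow>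
      Bseq (\<lambda>n. \<epsilon> n powr p * Lambda_plus (V n) (\<mu>\<^sub>n n) / (Lambda_minus (V n) (\<mu>\<^sub>n n))\<^sup>2) \<longrightarrow>
      Bseq (\<lambda>n. discrete_Lp_norm (V n) (\<mu>\<^sub>n n) p (u n)) \<longrightarrow>
      Bseq (\<lambda>n. graph_energy \<eta> p (\<epsilon> n) (V n) (\<mu>\<^sub>n n) (u n)) \<longrightarrow>
      (\<forall>r\<ge>1. TL_relatively_compact r \<Omega> (\<lambda>n. (zero_extension (V n) (u n), \<mu>\<^sub>n n)))"
proof -
  obtain s0 where s0: "0 < s0"
    "continuous (at 0 within {0..}) \<eta> \<Longrightarrow> 0 < \<eta> 0 \<Longrightarrow> \<forall>s. 0 \<le> s \<longrightarrow> s \<le> s0 \<longrightarrow> \<eta> 0 / 2 \<le> \<eta> s"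
  proof (cases "continuous (at 0 within {0..}) \<eta> \<and> 0 < \<eta> 0")
    case True
    then show ?thesis using kernel_lower_bound_near_0[of \<eta>] that by blast
  next
    case False
    then show ?thesis using that[of 1] by auto
  qed
  show ?thesis
  proof (rule exI[of _ "s0 / 4"], intro conjI allI impI)
    show "0 < s0 / 4" using s0(1) by simp
    fix p r :: real and \<mu> \<rho> and V :: "nat \<Rightarrow> 'a set" and \<nu> \<epsilon> u
    assume p: "real DIM('a) < p" and \<mu>: "prob_on \<Omega> \<mu>" "has_continuous_density \<Omega> \<mu> \<rho>"
      and graph: "\<forall>n. prob_on_finite \<Omega> (V n) (\<nu> n)"
      and \<epsilon>: "\<forall>n. 0 < \<epsilon> n" "\<epsilon> \<longlonglongrightarrow> 0"
      and maps: "\<exists>K>0. K \<le> s0 / 4 \<and>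
         (\<exists>T :: nat \<Rightarrow> 'a \<Rightarrow> 'a. \<forall>n.
            T n \<in> borel_measurable (restrict_space borel \<Omega>) \<and> T n \<in> \<Omega> \<rightarrow> V n \<and>
            distr \<mu> (restrict_space borel \<Omega>) (T n) = \<nu> n \<and>
            (SUP x\<in>\<Omega>. norm (T n x - x)) \<le> K * \<epsilon> n)"
      and \<eta>: "continuous (at 0 within {0..}) \<eta>" "0 < \<eta> 0"
      and \<rho>: "\<exists>D>0. \<forall>x\<in>\<Omega>. 1 / D \<le> \<rho> x \<and> \<rho> x \<le> D"
      and \<Lambda>: "\<forall>n. 0 < Lambda_minus (V n) (\<nu> n)"
      and bounds: "Bseq (\<lambda>n. \<epsilon> n powr p * Lambda_plus (V n) (\<nu> n) / (Lambda_minus (V n) (\<nu> n))\<^sup>2)"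
        "Bseq (\<lambda>n. discrete_Lp_norm (V n) (\<nu> n) p (u n))"
        "Bseq (\<lambda>n. graph_energy \<eta> p (\<epsilon> n) (V n) (\<nu> n) (u n))"
      and r: "1 \<le> r"
    from maps obtain K T where K: "K \<le> s0 / 4"
      and T: "\<And>n. T n \<in> borel_measurable (restrict_space borel \<Omega>)" "\<And>n. T n \<in> \<Omega> \<rightarrow> V n"
        "\<And>n. distr \<mu> (restrict_space borel \<Omega>) (T n) = \<nu> n"
        "\<And>n. (SUP x\<in>\<Omega>. norm (T n x - x)) \<le> K * \<epsilon> n" by blast
    obtain D where D: "0 < D" "\<And>x. x \<in> \<Omega> \<Longrightarrow> 1 / D \<le> \<rho> x" using \<rho> by blast
    obtain b where b: "\<And>x. x \<in> \<Omega> \<Longrightarrow> norm x \<le> b" using assms(2) by (auto simp: bounded_iff)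
    have close: "norm (T n x - x) \<le> K * \<epsilon> n" if x: "x \<in> \<Omega>" for n x
    proof -
      have "norm (T n y - y) \<le> 2 * b" if y: "y \<in> \<Omega>" for y
      proof -
        have "T n y \<in> \<Omega>" using T(2)[of n] graph y by (auto simp: prob_on_finite_def)
        then show ?thesis using b[OF y] b[of "T n y"] norm_triangle_ineq4[of "T n y" y] by linarith
      qed
      then have "norm (T n x - x) \<le> (SUP x\<in>\<Omega>. norm (T n x - x))"
        using x by (intro cSUP_upper bdd_aboveI2[of _ _ "2 * b"])
      then show ?thesis using T(4)[of n] by linarith
    qed
    obtain A where A: "0 < A" "\<And>n. norm (\<epsilon> n powr p * Lambda_plus (V n) (\<nu> n) / (Lambda_minus (V n) (\<nu> n))\<^sup>2) \<le> A"
      using BseqD[OF bounds(1)] by blast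
    obtain N where N: "0 < N" "\<And>n. norm (discrete_Lp_norm (V n) (\<nu> n) p (u n)) \<le> N"
      using BseqD[OF bounds(2)] by blast
    obtain E where E: "0 < E" "\<And>n. norm (graph_energy \<eta> p (\<epsilon> n) (V n) (\<nu> n) (u n)) \<le> E"
      using BseqD[OF bounds(3)] by blast
    show "TL_relatively_compact r \<Omega> (\<lambda>n. (zero_extension (V n) (u n), \<nu> n))"
    proof (rule graph_functions_relatively_compact[where c = "\<eta> 0 / 2" and ?s0.0 = s0 and \<eta> = \<eta> and \<epsilon> = \<epsilon>
          and p = p and K = K and A = A and N = N and E = E])
      show "transported_graph \<Omega> \<mu> \<rho> D (V n) (\<nu> n) (T n) (K * \<epsilon> n)" for n
        using assms \<mu> D graph T close by unfold_locales auto
      show "\<epsilon> n powr p * Lambda_plus (V n) (\<nu> n) / (Lambda_minus (V n) (\<nu> n))\<^sup>2 \<le> A" for n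
        using A(2)[of n] by (metis abs_le_D1 real_norm_def)
      show "discrete_Lp_norm (V n) (\<nu> n) p (u n) \<le> N" for n
        using N(2)[of n] by (metis abs_le_D1 real_norm_def)
      show "graph_energy \<eta> p (\<epsilon> n) (V n) (\<nu> n) (u n) \<le> E" for n
        using E(2)[of n] by (metis abs_le_D1 real_norm_def)
      show "\<eta> 0 / 2 \<le> \<eta> s" if "0 \<le> s" "s \<le> s0" for s
        using s0(2)[OF \<eta>] that by blast
    qed (use assms s0 p r \<epsilon> K \<Lambda> \<eta> A(1) N(1) E(1) in auto)
  qed
qed

end
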